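(* Let $N\in\mathbb N$, let $U$ be a complex Banach space and $Y^\infty=\ell^\infty(\mathbb Z^N,U)$. If $A=I+K$ with $K\in BDO(Y^\infty)$ norm-rich (almost periodic) and $\sigma^{\sf op}(K)$ uniformly Montel on $(Y^\infty,s)$, then the following statements are equivalent: (i) $A$ is invertible; (ii) $A$ is bounded below; (iii) all limit operators of $A$ are injective; (iv) all limit operators of $A$ are invertible with uniformly bounded inverses.
   Context: On $Y=Y^\infty=\ell^\infty(\mathbb Z^N,U)$ (sup norm), for $n\in\mathbb N_0$, $P_nx(m)=x(m)$ if $|m|\le n$ and $=0$ if $|m|>n$ ($|m|$ the max norm), $Q_n=I-P_n$, and $V_kx(m)=x(m-k)$ for $k\in\mathbb Z^N$. $x_n\stackrel{s}{\to}x$ means $\sup_n\|x_n\|<\infty$ and $\|P_m(x_n-x)\|\to0$ for every $m$. A set $\mathcal K\subset L(Y)$ is uniformly Montel on $(Y,s)$ if for all sequences $(K_n)\subset\mathcal K$ and all bounded $(x_n)\subset Y$, $(K_nx_n)$ has a subsequence that converges strictly to an element of $Y$. $K(Y,\mathcal P):=\{K\in L(Y):\|KQ_n\|\to0,\|Q_nK\|\to0\}$; $A_n\stackrel{\mathcal P}{\to}A$ means $\|(A_n-A)K\|\to0$ and $\|K(A_n-A)\|\to0$ for all $K\in K(Y,\mathcal P)$. If $h=(h(n))\subset\mathbb Z^N$ with $|h(n)|\to\infty$ and $V_{-h(n)}AV_{h(n)}\stackrel{\mathcal P}{\to}A_h\in L(Y)$, then $A_h$ is a limit operator of $A$; $\sigma^{\sf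 op}(A)$ is the set of all limit operators of $A$. $A\in L(Y)$ is norm-rich (= almost periodic) if $\{V_{-k}AV_k:k\in\mathbb Z^N\}$ is relatively compact in the norm topology of $L(Y)$. For $b\in\ell^\infty(\mathbb Z^N,L(U))$, $M_bx(m)=b(m)x(m)$. A band operator is a finite sum $\sum_{|k|\le w}M_{b_k}V_k$ with $b_k\in\ell^\infty(\mathbb Z^N,L(U))$; $BDO(Y)$ is the closure of the set of band operators in the norm of $L(Y)$. $A$ is bounded below if $\inf_{\|x\|=1}\|Ax\|>0$. *)

theory Defs
  imports "HOL-Analysis.Analysis"
begin

text \<open>The distribution only has real normed spaces. A complex normed space is a real one
  together with a scalar multiplication by complex numbers extending the real one.\<close>

class complex_normed_vector = real_normed_vector +
  fixes scaleC :: "complex \<Rightarrow> 'a \<Rightarrow> 'a"  (infixr "*\<^sub>C" 75)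
  assumes scaleC_add_right: "a *\<^sub>C (x + y) = a *\<^sub>C x + a *\<^sub>C y"
    and scaleC_add_left: "(a + b) *\<^sub>C x = a *\<^sub>C x + b *\<^sub>C x"
    and scaleC_scaleC: "a *\<^sub>C b *\<^sub>C x = (a * b) *\<^sub>C x"
    and scaleC_of_real: "complex_of_real r *\<^sub>C x = r *\<^sub>R x"
    and norm_scaleC: "norm (a *\<^sub>C x) = cmod a * norm x"

class complex_banach = complex_normed_vector + complete_space

subclass (in complex_banach) banach ..

lemma bounded_linear_scaleC: "bounded_linear (\<lambda>x. a *\<^sub>C (x :: 'a :: complex_normed_vector))"
proof (rule bounded_linear_intro[where K = "cmod a"])
  fix x y :: 'a and r :: real
  show "a *\<^sub>C (x + y) = a *\<^sub>C x + a *\<^sub>C y" by (rule scaleC_add_right)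
  show "a *\<^sub>C (r *\<^sub>R x) = r *\<^sub>R (a *\<^sub>C x)"
    by (simp add: scaleC_of_real[symmetric] scaleC_scaleC mult.commute)
  show "norm (a *\<^sub>C x) \<le> norm x * cmod a" by (simp add: norm_scaleC)
qed

text \<open>\<open>CL\<close> is the set of bounded complex-linear operators, realised as the (closed) subset of
  complex-linear elements of the space of bounded real-linear operators with the operator norm.\<close>

definition CL :: "('a::complex_normed_vector \<Rightarrow>\<^sub>L 'b::complex_normed_vector) set" where
  "CL = {A. \<forall>c x. blinfun_apply A (c *\<^sub>C x) = c *\<^sub>C blinfun_apply A x}"

lemma closed_CL: "closed (CL :: ('a::complex_normed_vector \<Rightarrow>\<^sub>L 'b::complex_normed_vector) set)"
proof -
  have *: "continuous_on UNIV
      (\<lambda>A :: 'a \<Rightarrow>\<^sub>L 'b. blinfun_apply A (c *\<^sub>C x) - c *\<^sub>C blinfun_apply A x)" for c x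
    by (intro continuous_intros bounded_linear.continuous_on[OF bounded_linear_scaleC])
  have "CL = (\<Inter>c. \<Inter>x. {A :: 'a \<Rightarrow>\<^sub>L 'b.
      blinfun_apply A (c *\<^sub>C x) - c *\<^sub>C blinfun_apply A x = 0})"
    by (auto simp: CL_def)
  also have "closed \<dots>"
    by (intro closed_INT ballI closed_Collect_eq * continuous_on_const)
  finally show ?thesis .
qed

unbundle bcontfun.lifting

instantiation bcontfun :: (topological_space, complex_normed_vector) complex_normed_vector
begin

lift_definition scaleC_bcontfun :: "complex \<Rightarrow> ('a \<Rightarrow>\<^sub>C 'b) \<Rightarrow> 'a \<Rightarrow>\<^sub>C 'b" is "\<lambda>c f x. c *\<^sub>C f x"
proof -
  fix c and f :: "'a \<Rightarrow> 'b"
  assume f: "f \<in> bcontfun"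
  have "bounded ((*\<^sub>C) c ` range f)"
    by (rule bounded_linear_image[OF _ bounded_linear_scaleC]) (use f in \<open>auto simp: bcontfun_def\<close>)
  moreover have "continuous_on UNIV (\<lambda>x. c *\<^sub>C f x)"
    using f by (intro bounded_linear.continuous_on[OF bounded_linear_scaleC]) (auto simp: bcontfun_def)
  ultimately show "(\<lambda>x. c *\<^sub>C f x) \<in> bcontfun"
    by (simp add: bcontfun_def image_image)
qed

instance
proof
  fix a b :: complex and r :: real and f g :: "'a \<Rightarrow>\<^sub>C 'b"
  show "a *\<^sub>C (f + g) = a *\<^sub>C f + a *\<^sub>C g"
    by (rule bcontfun_eqI) (simp add: scaleC_bcontfun.rep_eq scaleC_add_right)
  show "(a + b) *\<^sub>C f = a *\<^sub>C f + b *\<^sub>C f"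
    by (rule bcontfun_eqI) (simp add: scaleC_bcontfun.rep_eq scaleC_add_left)
  show "a *\<^sub>C b *\<^sub>C f = (a * b) *\<^sub>C f"
    by (rule bcontfun_eqI) (simp add: scaleC_bcontfun.rep_eq scaleC_scaleC)
  show "complex_of_real r *\<^sub>C f = r *\<^sub>R f"
    by (rule bcontfun_eqI) (simp add: scaleC_bcontfun.rep_eq scaleC_of_real)
  have le: "norm (c *\<^sub>C h) \<le> cmod c * norm h" for c and h :: "'a \<Rightarrow>\<^sub>C 'b"
    by (rule norm_bound)
      (simp add: scaleC_bcontfun.rep_eq norm_scaleC mult_left_mono norm_bounded)
  show "norm (a *\<^sub>C f) = cmod a * norm f"
  proof (cases "a = 0")
    case True
    then show ?thesis using le[of a f] by simp
  next
    case False
    have "inverse a *\<^sub>C a *\<^sub>C f = f"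
      by (rule bcontfun_eqI)
        (use False scaleC_of_real[of 1] in \<open>simp add: scaleC_bcontfun.rep_eq scaleC_scaleC\<close>)
    then have "norm f \<le> inverse (cmod a) * norm (a *\<^sub>C f)"
      using le[of "inverse a" "a *\<^sub>C f"] by (simp add: norm_inverse)
    then have "cmod a * norm f \<le> norm (a *\<^sub>C f)"
      using False by (simp add: field_simps)
    then show ?thesis using le[of a f] by simp
  qed
qed

end

text \<open>The index group \<open>\<int>\<^sup>N\<close> is the type \<open>int ^ 'n\<close>, with \<open>N = CARD('n) \<ge> 1\<close>. It is discrete, so
  bounded continuous functions on it are just bounded functions.\<close>

type_synonym ('n, 'u) linf = "(int ^ 'n) \<Rightarrow>\<^sub>C 'u"

lemma open_vec_int: "open (S :: (int ^ 'n::finite) set)"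
proof -
  have "open {x}" for x :: "int ^ 'n"
    unfolding open_vec_def
    by (auto intro!: exI[of _ "\<lambda>i. {x $ i}"] simp: open_discrete vec_eq_iff)
  then have "open (\<Union>x\<in>S. {x})" by blast
  then show ?thesis by simp
qed

lemma bcontfun_int_vec:
  "bcontfun = {f :: int ^ 'n::finite \<Rightarrow> 'a::metric_space. bounded (range f)}"
  by (auto simp: bcontfun_def continuous_on_open_vimage open_vec_int)

definition maxnorm :: "int ^ 'n \<Rightarrow> int" where
  "maxnorm m = Max (range (\<lambda>i. \<bar>m $ i\<bar>))"

lemma finite_maxnorm_le: "finite {k :: int ^ 'n. maxnorm k \<le> w}"
proof (rule finite_subset)
  show "{k :: int ^ 'n. maxnorm k \<le> w} \<subseteq> vec_lambda ` (UNIV \<rightarrow>\<^sub>E {- w..w})"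
  proof
    fix k :: "int ^ 'n" assume "k \<in> {k. maxnorm k \<le> w}"
    then have "\<bar>k $ i\<bar> \<le> w" for i by (auto simp: maxnorm_def)
    then have "vec_nth k \<in> UNIV \<rightarrow>\<^sub>E {- w..w}" by (auto simp: abs_le_iff minus_le_iff)
    then have "vec_lambda (vec_nth k) \<in> vec_lambda ` (UNIV \<rightarrow>\<^sub>E {- w..w})" by (rule imageI)
    then show "k \<in> vec_lambda ` (UNIV \<rightarrow>\<^sub>E {- w..w})" by simp
  qed
  show "finite (vec_lambda ` (UNIV \<rightarrow>\<^sub>E {- w..w}) :: (int ^ 'n) set)"
    by (intro finite_imageI finite_PiE) auto
qed

lift_definition trunc :: "nat \<Rightarrow> ('n::finite, 'u::real_normed_vector) linf \<Rightarrow> ('n, 'u) linf"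
  is "\<lambda>n x m. if maxnorm m \<le> int n then x m else 0"
proof -
  fix n :: nat and x :: "int ^ 'n \<Rightarrow> 'u"
  assume "x \<in> bcontfun"
  then obtain C where C: "norm (x m) \<le> C" for m
    unfolding bcontfun_int_vec bounded_iff by auto
  have "norm (if maxnorm m \<le> int n then x m else 0) \<le> C" for m
    using C[of m] norm_ge_zero[of "x m"] by (auto simp del: norm_ge_zero)
  then show "(\<lambda>m. if maxnorm m \<le> int n then x m else 0) \<in> bcontfun"
    unfolding bcontfun_int_vec bounded_iff by blast
qed

lift_definition opP :: "nat \<Rightarrow> ('n::finite, 'u::real_normed_vector) linf \<Rightarrow>\<^sub>L ('n, 'u) linf"
  is trunc
proof (rule bounded_linear_intro[where K = 1])
  fix n r and x y :: "('n, 'u) linf"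
  show "trunc n (x + y) = trunc n x + trunc n y"
    by (rule bcontfun_eqI) (simp add: trunc.rep_eq)
  show "trunc n (r *\<^sub>R x) = r *\<^sub>R trunc n x"
    by (rule bcontfun_eqI) (simp add: trunc.rep_eq)
  show "norm (trunc n x) \<le> norm x * 1"
    by (rule norm_bound) (simp add: trunc.rep_eq norm_bounded)
qed

definition opQ :: "nat \<Rightarrow> ('n::finite, 'u::real_normed_vector) linf \<Rightarrow>\<^sub>L ('n, 'u) linf" where
  "opQ n = id_blinfun - opP n"

lift_definition shift ::
  "int ^ 'n::finite \<Rightarrow> ('n, 'u::real_normed_vector) linf \<Rightarrow> ('n, 'u) linf"
  is "\<lambda>k x m. x (m - k)"
  unfolding bcontfun_int_vec bounded_iff by fastforce

lift_definition opV :: "int ^ 'n::finite \<Rightarrow> ('n, 'u::real_normed_vector) linf \<Rightarrow>\<^sub>L ('n, 'u) linf"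
  is shift
proof (rule bounded_linear_intro[where K = 1])
  fix k r and x y :: "('n, 'u) linf"
  show "shift k (x + y) = shift k x + shift k y"
    by (rule bcontfun_eqI) (simp add: shift.rep_eq)
  show "shift k (r *\<^sub>R x) = r *\<^sub>R shift k x"
    by (rule bcontfun_eqI) (simp add: shift.rep_eq)
  show "norm (shift k x) \<le> norm x * 1"
    by (rule norm_bound) (simp add: shift.rep_eq norm_bounded)
qed

lift_definition pmult ::
  "('n::finite, 'u \<Rightarrow>\<^sub>L 'u) linf \<Rightarrow> ('n, 'u::real_normed_vector) linf \<Rightarrow> ('n, 'u) linf"
  is "\<lambda>b x m. blinfun_apply (b m) (x m)"
proof -
  fix b :: "int ^ 'n \<Rightarrow> 'u \<Rightarrow>\<^sub>L 'u" and x :: "int ^ 'n \<Rightarrow> 'u"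
  assume "b \<in> bcontfun" "x \<in> bcontfun"
  then obtain B C where "\<And>m. norm (b m) \<le> B" "\<And>m. norm (x m) \<le> C"
    unfolding bcontfun_int_vec bounded_iff by auto
  then have "norm (blinfun_apply (b m) (x m)) \<le> B * C" for m
    by (meson norm_blinfun mult_mono norm_ge_zero order_trans)
  then show "(\<lambda>m. blinfun_apply (b m) (x m)) \<in> bcontfun"
    unfolding bcontfun_int_vec bounded_iff by auto
qed

lift_definition opM ::
  "('n::finite, 'u \<Rightarrow>\<^sub>L 'u) linf \<Rightarrow> ('n, 'u::real_normed_vector) linf \<Rightarrow>\<^sub>L ('n, 'u) linf"
  is pmult
proof -
  fix b :: "('n::finite, 'u \<Rightarrow>\<^sub>L 'u) linf"
  show "bounded_linear (pmult b)"
  proof (rule bounded_linear_intro[where K = "norm b"])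
    fix r and x y :: "('n, 'u) linf"
    show "pmult b (x + y) = pmult b x + pmult b y"
      by (rule bcontfun_eqI) (simp add: pmult.rep_eq blinfun.add_right)
    show "pmult b (r *\<^sub>R x) = r *\<^sub>R pmult b x"
      by (rule bcontfun_eqI) (simp add: pmult.rep_eq blinfun.scaleR_right)
    show "norm (pmult b x) \<le> norm x * norm b"
    proof (rule norm_bound)
      fix m
      have "norm (blinfun_apply (apply_bcontfun b m) (apply_bcontfun x m))
          \<le> norm (apply_bcontfun b m) * norm (apply_bcontfun x m)"
        by (rule norm_blinfun)
      also have "\<dots> \<le> norm b * norm x"
        by (intro mult_mono norm_bounded) auto
      finally show "norm (apply_bcontfun (pmult b x) m) \<le> norm x * norm b"
        by (simp add: pmult.rep_eq mult.commute)
    qed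
  qed
qed

definition strict_conv ::
  "(nat \<Rightarrow> ('n::finite, 'u::real_normed_vector) linf) \<Rightarrow> ('n, 'u) linf \<Rightarrow> bool" where
  "strict_conv x y \<longleftrightarrow>
     bounded (range x) \<and> (\<forall>m. (\<lambda>n. norm (blinfun_apply (opP m) (x n - y))) \<longlonglongrightarrow> 0)"

definition uniformly_Montel ::
  "(('n::finite, 'u::real_normed_vector) linf \<Rightarrow>\<^sub>L ('n, 'u) linf) set \<Rightarrow> bool" where
  "uniformly_Montel \<K> \<longleftrightarrow>
     (\<forall>K x. range K \<subseteq> \<K> \<longrightarrow> bounded (range x) \<longrightarrow>
        (\<exists>(r :: nat \<Rightarrow> nat) y. strict_mono r \<and> strict_conv (\<lambda>n. blinfun_apply (K (r n)) (x (r n))) y))"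

text \<open>The test operators \<open>K(Y, \<P>)\<close> defining \<open>\<P>\<close>-convergence.\<close>

definition KYP :: "(('n::finite, 'u::complex_normed_vector) linf \<Rightarrow>\<^sub>L ('n, 'u) linf) set" where
  "KYP = {K \<in> CL. (\<lambda>n. norm (K o\<^sub>L opQ n)) \<longlonglongrightarrow> 0 \<and> (\<lambda>n. norm (opQ n o\<^sub>L K)) \<longlonglongrightarrow> 0}"

definition P_conv ::
  "(nat \<Rightarrow> ('n::finite, 'u::complex_normed_vector) linf \<Rightarrow>\<^sub>L ('n, 'u) linf) \<Rightarrow>
   (('n, 'u) linf \<Rightarrow>\<^sub>L ('n, 'u) linf) \<Rightarrow> bool" where
  "P_conv A B \<longleftrightarrow>
     (\<forall>K \<in> KYP. (\<lambda>n. norm ((A n - B) o\<^sub>L K)) \<longlonglongrightarrow> 0 \<and> (\<lambda>n. norm (K o\<^sub>L (A n - B))) \<longlonglongrightarrow> 0)"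

definition sigma_op ::
  "(('n::finite, 'u::complex_normed_vector) linf \<Rightarrow>\<^sub>L ('n, 'u) linf) \<Rightarrow>
   (('n, 'u) linf \<Rightarrow>\<^sub>L ('n, 'u) linf) set" where
  "sigma_op A = {B \<in> CL. \<exists>h :: nat \<Rightarrow> int ^ 'n.
     filterlim (\<lambda>n. maxnorm (h n)) at_top sequentially \<and>
     P_conv (\<lambda>n. opV (- h n) o\<^sub>L A o\<^sub>L opV (h n)) B}"

definition norm_rich ::
  "(('n::finite, 'u::real_normed_vector) linf \<Rightarrow>\<^sub>L ('n, 'u) linf) \<Rightarrow> bool" where
  "norm_rich A \<longleftrightarrow> compact (closure (range (\<lambda>k. opV (- k) o\<^sub>L A o\<^sub>L opV k)))"

definition band_operators ::
  "(('n::finite, 'u::complex_normed_vector) linf \<Rightarrow>\<^sub>L ('n, 'u) linf) set" where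
  "band_operators =
     {B. \<exists>(w :: nat) (b :: int ^ 'n \<Rightarrow> ('n, 'u \<Rightarrow>\<^sub>L 'u) linf).
        (\<forall>k m. apply_bcontfun (b k) m \<in> CL) \<and>
        B = (\<Sum>k | maxnorm k \<le> int w. opM (b k) o\<^sub>L opV k)}"

definition BDO ::
  "(('n::finite, 'u::complex_normed_vector) linf \<Rightarrow>\<^sub>L ('n, 'u) linf) set" where
  "BDO = closure band_operators"

lemma band_operators_subset_CL:
  "(band_operators :: (('n::finite, 'u::complex_normed_vector) linf \<Rightarrow>\<^sub>L ('n, 'u) linf) set) \<subseteq> CL"
proof -
  have V: "(opV k :: ('n, 'u) linf \<Rightarrow>\<^sub>L ('n, 'u) linf) \<in> CL" for k
    unfolding CL_def
    by (auto intro!: bcontfun_eqI simp: opV.rep_eq shift.rep_eq scaleC_bcontfun.rep_eq)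
  have "opM b \<in> CL" if "\<forall>m. apply_bcontfun b m \<in> CL" for b :: "('n, 'u \<Rightarrow>\<^sub>L 'u) linf"
    using that unfolding CL_def
    by (auto intro!: bcontfun_eqI simp: opM.rep_eq pmult.rep_eq scaleC_bcontfun.rep_eq)
  with V have "opM (b k) o\<^sub>L opV k \<in> CL"
    if "\<forall>k m. apply_bcontfun (b k) m \<in> CL" for b :: "int ^ 'n \<Rightarrow> ('n, 'u \<Rightarrow>\<^sub>L 'u) linf" and k
    using that by (simp add: CL_def)
  then show ?thesis
    by (auto simp: band_operators_def CL_def blinfun.sum_left
        linear_sum[OF bounded_linear.linear[OF bounded_linear_scaleC]])
qed

lemma BDO_subset_CL: "BDO \<subseteq> CL"
  unfolding BDO_def by (rule closure_minimal[OF band_operators_subset_CL closed_CL])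

definition is_inverse ::
  "('a::complex_normed_vector \<Rightarrow>\<^sub>L 'a) \<Rightarrow> ('a \<Rightarrow>\<^sub>L 'a) \<Rightarrow> bool" where
  "is_inverse A B \<longleftrightarrow> B \<in> CL \<and> A o\<^sub>L B = id_blinfun \<and> B o\<^sub>L A = id_blinfun"

text \<open>The infimum is taken in the extended reals, so that it is \<open>\<infinity>\<close> (and every operator is
  bounded below) on the zero space, where the unit sphere is empty.\<close>

definition bounded_below :: "('a::real_normed_vector \<Rightarrow>\<^sub>L 'b::real_normed_vector) \<Rightarrow> bool" where
  "bounded_below A \<longleftrightarrow> (INF x\<in>{x. norm x = 1}. ereal (norm (blinfun_apply A x))) > 0"

end

theory Submission
  imports Defs
begin

text \<open>The implications (i) \<open>\<Longrightarrow>\<close> (ii) and (iv) \<open>\<Longrightarrow>\<close> (iii) are immediate.  The others rest on one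
  consequence of almost periodicity: the limit operators of \<open>K\<close> are exactly the norm limits of
  sequences of translates \<open>V\<^bsub>-k\<^esub> K V\<^bsub>k\<^esub>\<close> (\<open>sigma_op_eq_translation_hull\<close>).  One inclusion is
  compactness together with uniqueness of \<open>\<P>\<close>-limits.  For the other, a sequence of translates can be pushed to
  infinity by adding almost periods, at an arbitrarily small cost in norm.  So (i) and (ii) pass from
  \<open>A\<close> to its translates with the same constants and from these to norm limits, which gives
  (ii) \<open>\<Longrightarrow>\<close> (iii) and (i) \<open>\<Longrightarrow>\<close> (iv).

  What remains is (iii) \<open>\<Longrightarrow>\<close> (i).  The basic device (\<open>no_approximate_kernel\<close>) is that, under (iii),
  there is no bounded sequence \<open>x\<^sub>j\<close> such that \<open>x\<^sub>j\<close> has size at least \<open>c > 0\<close> at some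
  point \<open>k\<^sub>j\<close> while \<open>A x\<^sub>j\<close> tends to zero around \<open>k\<^sub>j\<close>: after moving \<open>k\<^sub>j\<close> to the origin, the
  uniform Montel property and norm compactness of the hull produce a strict limit that is a
  nonzero element of the kernel of a limit operator.  It yields at once that \<open>A\<close> is bounded below.

  Surjectivity needs a Fredholm argument, which is carried out on periodic sequences.  Choose \<open>L\<close> such that
  the translates of \<open>K\<close> by \<open>L k\<close>, for \<open>k\<close> of max norm at most 1, are all close to \<open>K\<close>, and let \<open>E\<close>
  be the operator that restricts a sequence to a box of side \<open>L\<close> around the origin and extends it
  periodically.  As \<open>E w\<close> depends on finitely many entries of \<open>w\<close>, the Montel property makes
  \<open>E K\<close> compact.  On an \<open>L\<close>-periodic \<open>x\<close> the sequences \<open>x + E K x\<close> and \<open>A x\<close> almost agree near the box,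
  including across its faces, where the choice of \<open>L\<close> enters (\<open>periodisation_residual\<close>).  Hence the
  basic device bounds \<open>I + E K\<close> below on \<open>L\<close>-periodic sequences, uniformly for large \<open>L\<close>; this includes
  every possible element of its kernel, so \<open>I + E K\<close> is injective and, by the theory of Riesz,
  surjective.  The solutions \<open>x\<^sub>L\<close> of \<open>x\<^sub>L + E K x\<^sub>L = E y\<close> are bounded, a subsequence converges
  strictly by the Montel property, and since \<open>E\<close> fixes any given entry for large \<open>L\<close>, the limit
  solves \<open>A x = y\<close>.\<close>

section \<open>Lower bounds and inverses\<close>

lemma lower_bound_of_unit_vectors:
  fixes T :: "'a::real_normed_vector \<Rightarrow>\<^sub>L 'b::real_normed_vector"
  assumes S: "\<And>t x. x \<in> S \<Longrightarrow> t *\<^sub>R x \<in> S"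
    and unit: "\<And>x. x \<in> S \<Longrightarrow> norm x = 1 \<Longrightarrow> c \<le> norm (T x)"
    and x: "x \<in> S"
  shows "c * norm x \<le> norm (T x)"
proof (cases "x = 0")
  case False
  have "c \<le> norm (T ((1 / norm x) *\<^sub>R x))"
    using False by (intro unit S x) simp
  also have "\<dots> = norm (T x) / norm x"
    by (simp add: blinfun.scaleR_right)
  finally show ?thesis using False by (simp add: field_simps)
qed simp

text \<open>The form in which a missing lower bound is used: it supplies normalised approximate kernel
  vectors inside any set closed under scaling.\<close>

lemma unit_vector_below:
  fixes T :: "'a::real_normed_vector \<Rightarrow>\<^sub>L 'b::real_normed_vector"
  assumes S: "\<And>t x. x \<in> S \<Longrightarrow> t *\<^sub>R x \<in> S"
    and x: "x \<in> S" "\<not> c * norm x \<le> norm (T x)"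
  obtains u where "u \<in> S" "norm u = 1" "norm (T u) \<le> c"
  using lower_bound_of_unit_vectors[of S c T x] assms by (meson le_cases)

lemma bounded_below_iff:
  fixes T :: "'a::real_normed_vector \<Rightarrow>\<^sub>L 'b::real_normed_vector"
  shows "bounded_below T \<longleftrightarrow> (\<exists>c>0. \<forall>x. c * norm x \<le> norm (T x))"
proof
  assume "bounded_below T"
  then obtain c where c: "0 < ereal c" "ereal c < (INF x\<in>{x. norm x = 1}. ereal (norm (T x)))"
    unfolding bounded_below_def using ereal_dense2 by blast
  have "c \<le> norm (T x)" if "norm x = 1" for x
    using less_INF_D[OF c(2), of x] that by simp
  then have "c * norm x \<le> norm (T x)" for x
    using lower_bound_of_unit_vectors[of UNIV c T x] by simp
  then show "\<exists>c>0. \<forall>x. c * norm x \<le> norm (T x)" using c(1) by auto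
next
  assume "\<exists>c>0. \<forall>x. c * norm x \<le> norm (T x)"
  then obtain c where c: "c > 0" "\<And>x. c * norm x \<le> norm (T x)" by blast
  have "ereal c \<le> (INF x\<in>{x. norm x = 1}. ereal (norm (T x)))"
  proof (rule INF_greatest)
    fix x :: 'a assume "x \<in> {x. norm x = 1}"
    then show "ereal c \<le> ereal (norm (T x))" using c(2)[of x] by simp
  qed
  then show "bounded_below T"
    unfolding bounded_below_def using c(1) by (meson ereal_less(2) less_le_trans)
qed

lemma is_inverse_of_lower_bound:
  fixes A :: "'a::complex_normed_vector \<Rightarrow>\<^sub>L 'a"
  assumes CL: "A \<in> CL" and c: "c > 0" "\<And>x. c * norm x \<le> norm (A x)"
    and surj: "\<And>y. \<exists>x. A x = y"
  shows "\<exists>D. is_inverse A D \<and> norm D \<le> 1 / c"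
proof -
  have inj: "x = y" if "A x = A y" for x y
    using c(1) c(2)[of "x - y"] that by (simp add: blinfun.diff_right mult_le_0_iff)
  from surj obtain g where g: "\<And>y. A (g y) = y" by metis
  have bd: "norm (g y) \<le> norm y * (1 / c)" for y
    using c(1) c(2)[of "g y"] by (simp add: g field_simps)
  have lin: "bounded_linear g"
    by (rule bounded_linear_intro[OF _ _ bd]; rule inj; simp add: blinfun.add_right blinfun.scaleR_right g)
  define D where "D = Blinfun g"
  have D: "D y = g y" for y
    by (simp add: D_def bounded_linear_Blinfun_apply[OF lin])
  have "g (a *\<^sub>C x) = a *\<^sub>C g x" for a x
    by (rule inj) (use CL in \<open>simp add: CL_def g\<close>)
  moreover have "g (A x) = x" for x by (rule inj) (rule g)
  ultimately have "is_inverse A D"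
    by (auto simp: is_inverse_def CL_def D g intro!: blinfun_eqI)
  moreover have "norm D \<le> 1 / c"
    using bd c(1) by (intro norm_blinfun_bound) (auto simp: D mult.commute)
  ultimately show ?thesis by blast
qed

text \<open>Uniformly bounded inverses converge along with the operators, because the resolvent identity
  \<open>D\<^sub>m - D\<^sub>n = D\<^sub>m (A\<^sub>n - A\<^sub>m) D\<^sub>n\<close> makes them a Cauchy sequence.\<close>

lemma is_inverse_limit:
  fixes A :: "nat \<Rightarrow> 'a::{complex_normed_vector, banach} \<Rightarrow>\<^sub>L 'a"
  assumes lim: "A \<longlonglongrightarrow> B" and inv: "\<And>n. is_inverse (A n) (D n)" and bd: "\<And>n. norm (D n) \<le> C"
  shows "\<exists>D. is_inverse B D \<and> norm D \<le> C"
proof -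
  have AD: "A n (D n x) = x" and DA: "D n (A n x) = x" for n x
    using inv[of n] unfolding is_inverse_def
    by (metis blinfun_apply_blinfun_compose blinfun_apply_id_blinfun id_apply)+
  have C: "0 \<le> C" using norm_ge_zero[of "D 0"] bd[of 0] by linarith
  have resolvent: "D m - D n = D m o\<^sub>L (A n - A m) o\<^sub>L D n" for m n
    by (intro blinfun_eqI) (simp add: blinfun.diff_left blinfun.diff_right AD DA)
  have le: "norm (D m - D n) \<le> C * norm (A n - A m) * C" for m n
  proof -
    have "norm (D m - D n) \<le> norm (D m o\<^sub>L (A n - A m)) * norm (D n)"
      unfolding resolvent by (rule norm_blinfun_compose)
    also have "\<dots> \<le> (norm (D m) * norm (A n - A m)) * norm (D n)"
      by (intro mult_right_mono norm_blinfun_compose) auto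
    also have "\<dots> \<le> (C * norm (A n - A m)) * C"
      using C by (intro mult_mono bd) auto
    finally show ?thesis .
  qed
  have "Cauchy D"
  proof (rule CauchyI)
    fix e :: real assume e: "e > 0"
    have pos: "C * C + 1 > 0" using C by (simp add: add_nonneg_pos)
    then have "e / (C * C + 1) > 0" using e by simp
    then obtain M where M: "\<And>m n. m \<ge> M \<Longrightarrow> n \<ge> M \<Longrightarrow> norm (A m - A n) < e / (C * C + 1)"
      using CauchyD[OF LIMSEQ_imp_Cauchy[OF lim]] by blast
    have "norm (D m - D n) < e" if "m \<ge> M" "n \<ge> M" for m n
    proof -
      have "norm (D m - D n) \<le> C * C * norm (A n - A m)"
        using le[of m n] by (simp add: mult_ac)
      also have "\<dots> \<le> (C * C + 1) * norm (A n - A m)"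
        by (intro mult_right_mono) auto
      also have "\<dots> < e"
        using M[OF that(2,1)] pos by (simp add: pos_less_divide_eq mult.commute)
      finally show ?thesis .
    qed
    then show "\<exists>M. \<forall>m\<ge>M. \<forall>n\<ge>M. norm (D m - D n) < e" by blast
  qed
  then obtain E where E: "D \<longlonglongrightarrow> E"
    unfolding Cauchy_convergent_iff convergent_def by blast
  have "(\<lambda>n. A n o\<^sub>L D n) \<longlonglongrightarrow> (B o\<^sub>L E)" "(\<lambda>n. D n o\<^sub>L A n) \<longlonglongrightarrow> (E o\<^sub>L B)"
    by (rule bounded_bilinear.tendsto[OF bounded_bilinear_blinfun_compose lim E]
      bounded_bilinear.tendsto[OF bounded_bilinear_blinfun_compose E lim])+
  then have "B o\<^sub>L E = id_blinfun" "E o\<^sub>L B = id_blinfun"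
    using inv by (simp_all add: is_inverse_def LIMSEQ_const_iff)
  moreover have "E \<in> CL"
    using closed_sequentially[OF closed_CL _ E] inv by (simp add: is_inverse_def)
  moreover have "norm E \<le> C"
    by (rule tendsto_upperbound[OF tendsto_norm[OF E]]) (auto simp: bd)
  ultimately show ?thesis by (auto simp: is_inverse_def)
qed

section \<open>Injective compact perturbations of the identity are surjective\<close>

text \<open>Normalised approximate kernel vectors \<open>u\<^sub>n\<close> of \<open>I + C\<close> satisfy \<open>u\<^sub>n \<approx> - C u\<^sub>n\<close>, so compactness makes
  a subsequence converge, and the limit is a unit vector in the kernel.\<close>

lemma bounded_below_of_compact_perturbation:
  fixes C :: "'a::real_normed_vector \<Rightarrow>\<^sub>L 'a"
  assumes cpt: "\<And>x :: nat \<Rightarrow> 'a. bounded (range x) \<Longrightarrow> \<exists>r :: nat \<Rightarrow> nat. strict_mono r \<and> convergent (\<lambda>n. C (x (r n)))"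
    and inj: "\<And>x. x + C x = 0 \<Longrightarrow> x = 0"
  shows "\<exists>c>0. \<forall>x. c * norm x \<le> norm (x + C x)"
proof (rule ccontr)
  assume "\<not> ?thesis"
  then have neg: "\<not> (\<forall>x. c * norm x \<le> norm (x + C x))" if "c > 0" for c
    using that by blast
  have "\<exists>u. norm u = 1 \<and> norm (u + C u) \<le> inverse (real (Suc n))" for n
  proof -
    obtain v where "\<not> inverse (real (Suc n)) * norm v \<le> norm ((id_blinfun + C) v)"
      using neg[of "inverse (real (Suc n))"] by (auto simp: blinfun.add_left)
    then obtain u where "norm u = 1" "norm ((id_blinfun + C) u) \<le> inverse (real (Suc n))"
      using unit_vector_below[of UNIV] by (metis UNIV_I)
    then show ?thesis by (auto simp: blinfun.add_left)
  qed
  then have "\<exists>u. \<forall>n. norm (u n) = 1 \<and> norm (u n + C (u n)) \<le> inverse (real (Suc n))"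
    by (intro choice allI)
  then obtain u where nu: "\<And>n. norm (u n) = 1"
    and le: "\<And>n. norm (u n + C (u n)) \<le> inverse (real (Suc n))"
    by blast
  have lim0: "(\<lambda>n. u n + C (u n)) \<longlonglongrightarrow> 0"
    by (rule Lim_null_comparison[OF always_eventually LIMSEQ_inverse_real_of_nat])
      (use le in blast)
  have "bounded (range u)"
    by (rule boundedI[where B = 1]) (auto simp: nu)
  from cpt[OF this] obtain r :: "nat \<Rightarrow> nat" and w
    where r: "strict_mono r" and w: "(\<lambda>n. C (u (r n))) \<longlonglongrightarrow> w"
    by (auto simp: convergent_def)
  have "(\<lambda>n. (u (r n) + C (u (r n))) - C (u (r n))) \<longlonglongrightarrow> 0 - w"
    by (rule tendsto_diff[OF LIMSEQ_subseq_LIMSEQ[OF lim0 r, unfolded o_def] w])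
  then have u: "(\<lambda>n. u (r n)) \<longlonglongrightarrow> - w" by simp
  have "(\<lambda>n. C (u (r n))) \<longlonglongrightarrow> C (- w)"
    by (rule blinfun.tendsto[OF tendsto_const u])
  with w have "C (- w) = w" by (rule LIMSEQ_unique[symmetric])
  then have "- w + C (- w) = 0" by simp
  then have "- w = 0" by (rule inj)
  moreover have "norm (- w) = 1"
    using tendsto_norm[OF u] by (simp add: nu LIMSEQ_const_iff)
  ultimately show False by simp
qed

text \<open>The lemma of Riesz on almost orthogonal vectors.  The unit vector is given as a multiple of \<open>v - s\<close>, so that
  it stays in every subspace containing \<open>v\<close> and \<open>S\<close>.\<close>

lemma riesz_almost_orthogonal:
  fixes S :: "'a::real_normed_vector set"
  assumes S: "subspace S" "closed S" and v: "v \<notin> S"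
  obtains s t where "s \<in> S" "norm (t *\<^sub>R (v - s)) = 1" "\<And>w. w \<in> S \<Longrightarrow> 1 / 2 \<le> norm (t *\<^sub>R (v - s) - w)"
proof -
  have ne: "S \<noteq> {}" using subspace_0[OF S(1)] by blast
  define d where "d = infdist v S"
  have "d \<noteq> 0" using in_closed_iff_infdist_zero[OF S(2) ne] v by (simp add: d_def)
  then have d: "d > 0" using infdist_nonneg[of v S] by (simp add: d_def)
  then have "infdist v S < 2 * d" by (simp add: d_def)
  then obtain s where s: "s \<in> S" "dist v s < 2 * d"
    using ne by (auto simp: infdist_notempty cINF_less_iff)
  have pos: "norm (v - s) > 0" using s v by auto
  define t where "t = inverse (norm (v - s))"
  show thesis
  proof (rule that[of s t])
    show "norm (t *\<^sub>R (v - s)) = 1" using pos by (simp add: t_def)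
    fix w assume w: "w \<in> S"
    have "s + norm (v - s) *\<^sub>R w \<in> S"
      using s w S(1) by (simp add: subspace_add subspace_scale)
    then have "d \<le> norm (v - (s + norm (v - s) *\<^sub>R w))"
      unfolding d_def by (metis dist_norm infdist_le)
    also have "v - (s + norm (v - s) *\<^sub>R w) = norm (v - s) *\<^sub>R (t *\<^sub>R (v - s) - w)"
      using pos by (simp add: t_def algebra_simps)
    also have "norm \<dots> = norm (v - s) * norm (t *\<^sub>R (v - s) - w)" by simp
    also have "\<dots> \<le> 2 * d * norm (t *\<^sub>R (v - s) - w)"
      using s by (intro mult_right_mono) (auto simp: dist_norm)
    finally show "1 / 2 \<le> norm (t *\<^sub>R (v - s) - w)" using d by simp
  qed (use s in auto)
qed

text \<open>The argument of Riesz.  If \<open>T = I + C\<close> is injective but misses \<open>y\<close>, the ranges of the powers of \<open>T\<close> form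
  a strictly decreasing chain, since \<open>T\<^sup>n y\<close> is not in the range of \<open>T\<^sup>n\<^sup>+\<^sup>1\<close>, and they are closed because
  \<open>T\<close> is bounded below.  Almost orthogonal unit vectors \<open>u\<^sub>n\<close> chosen along the chain have images
  under \<open>C\<close> at mutual distance at least \<open>1/2\<close>, against compactness.\<close>

lemma surj_of_inj_compact_perturbation:
  fixes C :: "'a::banach \<Rightarrow>\<^sub>L 'a"
  assumes cpt: "\<And>x :: nat \<Rightarrow> 'a. bounded (range x) \<Longrightarrow> \<exists>r :: nat \<Rightarrow> nat. strict_mono r \<and> convergent (\<lambda>n. C (x (r n)))"
    and inj: "\<And>x. x + C x = 0 \<Longrightarrow> x = 0"
  shows "\<exists>x. x + C x = y"
proof (rule ccontr)
  assume y: "\<nexists>x. x + C x = y"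
  define T where "T = id_blinfun + C"
  have T: "T x = x + C x" for x by (simp add: T_def blinfun.add_left)
  obtain c where c: "c > 0" "\<And>x. c * norm x \<le> norm (T x)"
    using bounded_below_of_compact_perturbation[OF cpt inj] by (auto simp: T)
  have injT: "T a = T b \<Longrightarrow> a = b" for a b
    using inj[of "a - b"] by (simp add: T blinfun.diff_right algebra_simps)
  define R where "R n = range (blinfun_apply T ^^ n)" for n
  have R_Suc: "R (Suc n) = T ` R n" for n
    by (auto simp: R_def)
  have R: "subspace (R n) \<and> complete (R n)" for n
  proof (induction n)
    case 0
    show ?case by (simp add: R_def complete_UNIV)
  next
    case (Suc n)
    then show ?case unfolding R_Suc
      using complete_isometric_image[OF c(1), of "R n" T] c(2)
      by (simp add: blinfun.bounded_linear_right linear_subspace_image bounded_linear.linear)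
  qed
  have anti: "R (n + k) \<subseteq> R n" for n k
    by (auto simp: R_def funpow_add)
  have mono: "R m \<subseteq> R n" if "n \<le> m" for m n
    using anti[of n "m - n"] that by simp
  have notin: "(blinfun_apply T ^^ n) y \<notin> R (Suc n)" for n
  proof (induction n)
    case 0
    show ?case using y by (auto simp: R_def T)
  next
    case (Suc n)
    then show ?case using injT by (auto simp: R_Suc[of "Suc n"])
  qed
  have "\<forall>n. \<exists>u. u \<in> R n \<and> norm u = 1 \<and> (\<forall>w \<in> R (Suc n). 1 / 2 \<le> norm (u - w))"
  proof
    fix n
    let ?v = "(blinfun_apply T ^^ n) y"
    have "subspace (R (Suc n))" "closed (R (Suc n))" using R by (auto simp: complete_imp_closed)
    then obtain s t where st: "s \<in> R (Suc n)" "norm (t *\<^sub>R (?v - s)) = 1"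
      "\<And>w. w \<in> R (Suc n) \<Longrightarrow> 1 / 2 \<le> norm (t *\<^sub>R (?v - s) - w)"
      using riesz_almost_orthogonal[OF _ _ notin[of n]] by blast
    have "?v \<in> R n" by (auto simp: R_def)
    moreover have "s \<in> R n" using st(1) mono[of n "Suc n"] by auto
    ultimately have "t *\<^sub>R (?v - s) \<in> R n"
      using R[of n] by (simp add: subspace_diff subspace_scale)
    with st show "\<exists>u. u \<in> R n \<and> norm u = 1 \<and> (\<forall>w \<in> R (Suc n). 1 / 2 \<le> norm (u - w))"
      by blast
  qed
  from choice[OF this]
  obtain u where u: "\<And>n. u n \<in> R n" "\<And>n. norm (u n) = 1"
    "\<And>n w. w \<in> R (Suc n) \<Longrightarrow> 1 / 2 \<le> norm (u n - w)"
    by blast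
  have sep: "1 / 2 \<le> norm (C (u n) - C (u m))" if "n < m" for n m
  proof -
    \<comment> \<open>\<open>C (u n) - C (u m) = - (u n - w)\<close>, where \<open>w\<close> lies in the next space of the chain after that of \<open>u n\<close>\<close>
    define w where "w = T (u n) - T (u m) + u m"
    have "T (u n) \<in> R (Suc n)" "T (u m) \<in> R (Suc m)" using u by (auto simp: R_Suc)
    moreover have "R (Suc m) \<subseteq> R (Suc n)" "R m \<subseteq> R (Suc n)"
      using that by (simp_all add: mono)
    ultimately have "w \<in> R (Suc n)"
      unfolding w_def using R[of "Suc n"] u(1)[of m] by (meson subset_iff subspace_add subspace_diff)
    then have "1 / 2 \<le> norm (u n - w)" by (rule u)
    also have "u n - w = - (C (u n) - C (u m))" by (simp add: w_def T)
    finally show ?thesis by (simp add: norm_minus_commute)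
  qed
  have "bounded (range u)" by (rule boundedI[where B = 1]) (auto simp: u)
  from cpt[OF this] obtain r :: "nat \<Rightarrow> nat" where r: "strict_mono r" "convergent (\<lambda>n. C (u (r n)))"
    by blast
  from LIMSEQ_imp_Cauchy r(2) have "Cauchy (\<lambda>n. C (u (r n)))"
    by (auto simp: convergent_def)
  then obtain M where "\<And>m n. m \<ge> M \<Longrightarrow> n \<ge> M \<Longrightarrow> norm (C (u (r m)) - C (u (r n))) < 1 / 2"
    using CauchyD[of "\<lambda>n. C (u (r n))" "1/2"] by auto
  then have "norm (C (u (r M)) - C (u (r (Suc M)))) < 1 / 2" by simp
  moreover have "r M < r (Suc M)" using r(1) by (simp add: strict_mono_Suc_iff)
  ultimately show False using sep[of "r M" "r (Suc M)"] by linarith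
qed

section \<open>Strict convergence is bounded pointwise convergence\<close>

lemma maxnorm_le_iff: "maxnorm m \<le> c \<longleftrightarrow> (\<forall>i. \<bar>m $ i\<bar> \<le> c)"
  unfolding maxnorm_def by (subst Max_le_iff) auto

lemma nth_le_maxnorm: "\<bar>m $ i\<bar> \<le> maxnorm m"
  using maxnorm_le_iff[of m "maxnorm m"] by simp

lemma maxnorm_nonneg [simp]: "0 \<le> maxnorm m"
  using nth_le_maxnorm[of m] abs_ge_zero order_trans by blast

lemma opP_nth: "opP n x m = (if maxnorm m \<le> int n then x m else 0)"
  by (simp add: opP.rep_eq trunc.rep_eq)

lemma opV_nth: "opV k x m = x (m - k)"
  by (simp add: opV.rep_eq shift.rep_eq)

lemma opM_nth: "opM b x m = b m (x m)"
  by (simp add: opM.rep_eq pmult.rep_eq)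

lemma scaleC_nth: "apply_bcontfun (c *\<^sub>C x) m = c *\<^sub>C apply_bcontfun x m"
  by (simp add: scaleC_bcontfun.rep_eq)

lemma norm_opV [simp]: "norm (opV k x) = norm x"
proof (rule antisym)
  show "norm (opV k x) \<le> norm x"
    by (rule norm_bound) (simp add: opV_nth norm_bounded)
  have "norm (x m) \<le> norm (opV k x)" for m
    using norm_bounded[of "opV k x" "m + k"] by (simp add: opV_nth)
  then show "norm x \<le> norm (opV k x)" by (rule norm_bound)
qed

lemma opV_opV: "opV k o\<^sub>L opV l = opV (k + l)"
  by (intro blinfun_eqI bcontfun_eqI) (simp add: opV_nth algebra_simps)

lemma opV_opV_apply [simp]: "opV k (opV l x) = opV (k + l) x"
  using opV_opV[of k l] by (metis blinfun_apply_blinfun_compose)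

lemma opV_0 [simp]: "opV 0 = id_blinfun"
  by (intro blinfun_eqI bcontfun_eqI) (simp add: opV_nth)

text \<open>Only finitely many entries survive in \<open>P\<^sub>m x\<close>, so norm convergence of all these truncations is convergence
  entry by entry.\<close>

lemma strict_conv_iff:
  "strict_conv x y \<longleftrightarrow> bounded (range x) \<and> (\<forall>m. (\<lambda>n. x n m) \<longlonglongrightarrow> y m)"
proof (intro iffI conjI allI)
  assume *: "strict_conv x y"
  then show "bounded (range x)" by (simp add: strict_conv_def)
  fix m
  have le: "norm (x n m - y m) \<le> norm (opP (nat (maxnorm m)) (x n - y))" for n
    using norm_bounded[of "opP (nat (maxnorm m)) (x n - y)" m]
    by (simp add: opP_nth)
  have "(\<lambda>n. norm (opP (nat (maxnorm m)) (x n - y))) \<longlonglongrightarrow> 0"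
    using * by (simp add: strict_conv_def)
  then have "(\<lambda>n. x n m - y m) \<longlonglongrightarrow> 0"
    by (rule Lim_null_comparison[rotated]) (use le in auto)
  then show "(\<lambda>n. x n m) \<longlonglongrightarrow> y m" by (rule Lim_null[THEN iffD2])
next
  assume *: "bounded (range x) \<and> (\<forall>m. (\<lambda>n. x n m) \<longlonglongrightarrow> y m)"
  have "(\<lambda>n. norm (opP k (x n - y))) \<longlonglongrightarrow> 0" for k
  proof -
    have le: "norm (opP k (x n - y)) \<le> (\<Sum>m | maxnorm m \<le> int k. norm (x n m - y m))" for n
    proof (rule norm_bound)
      fix m
      show "norm (opP k (x n - y) m) \<le> (\<Sum>m | maxnorm m \<le> int k. norm (x n m - y m))"
        by (auto simp: opP_nth finite_maxnorm_le intro!: member_le_sum sum_nonneg)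
    qed
    have "(\<lambda>n. norm (x n m - y m)) \<longlonglongrightarrow> 0" for m
      using * by (auto intro!: tendsto_norm_zero LIM_zero)
    then have "(\<lambda>n. \<Sum>m | maxnorm m \<le> int k. norm (x n m - y m)) \<longlonglongrightarrow> 0"
      by (intro tendsto_null_sum)
    then have "(\<lambda>n. opP k (x n - y)) \<longlonglongrightarrow> 0"
      by (rule Lim_null_comparison[rotated]) (use le in auto)
    then show ?thesis by (rule tendsto_norm_zero)
  qed
  with * show "strict_conv x y" by (simp add: strict_conv_def)
qed

text \<open>Continuity for strict convergence of sequences, the property of band-dominated operators that
  the proof uses.\<close>

definition s_continuous ::
  "(('n::finite, 'u::real_normed_vector) linf \<Rightarrow>\<^sub>L ('n, 'u) linf) \<Rightarrow> bool" where
  "s_continuous B \<longleftrightarrow> (\<forall>x y. strict_conv x y \<longrightarrow> strict_conv (\<lambda>n. B (x n)) (B y))"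

lemma bounded_range_blinfun:
  "bounded (range x) \<Longrightarrow> bounded (range (\<lambda>n. blinfun_apply B (x n)))"
  using bounded_linear_image[of "range x" "blinfun_apply B"] by (simp add: image_image blinfun.bounded_linear_right)

lemma s_continuousI:
  fixes B :: "('n::finite, 'u::real_normed_vector) linf \<Rightarrow>\<^sub>L ('n, 'u) linf"
  assumes "\<And>x y m. strict_conv x y \<Longrightarrow> (\<lambda>n. B (x n) m) \<longlonglongrightarrow> B y m"
  shows "s_continuous B"
  using assms unfolding s_continuous_def
  by (auto simp: strict_conv_iff bounded_range_blinfun)

lemma s_continuousD:
  fixes B :: "('n::finite, 'u::real_normed_vector) linf \<Rightarrow>\<^sub>L ('n, 'u) linf"
  shows "s_continuous B \<Longrightarrow> strict_conv x y \<Longrightarrow> (\<lambda>n. B (x n) m) \<longlonglongrightarrow> B y m"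
  unfolding s_continuous_def by (auto simp: strict_conv_iff)

lemma s_continuous_compose:
  "s_continuous B \<Longrightarrow> s_continuous C \<Longrightarrow> s_continuous (B o\<^sub>L C)"
  by (simp add: s_continuous_def)

lemma s_continuous_opV: "s_continuous (opV k)"
  by (rule s_continuousI) (auto simp: opV_nth strict_conv_iff)

lemma s_continuous_opM: "s_continuous (opM b)"
  by (rule s_continuousI) (auto simp: opM_nth strict_conv_iff intro!: tendsto_intros)

lemma sum_nth: "sum f S m = (\<Sum>i\<in>S. f i m)" for f :: "_ \<Rightarrow> ('a::topological_space \<Rightarrow>\<^sub>C 'b::real_normed_vector)"
  by (induction S rule: infinite_finite_induct) auto

lemma s_continuous_sum:
  "(\<And>i. i \<in> S \<Longrightarrow> s_continuous (B i)) \<Longrightarrow> s_continuous (\<Sum>i\<in>S. B i)"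
  by (rule s_continuousI)
    (auto simp: blinfun.sum_left sum_nth intro!: tendsto_sum s_continuousD)

lemma norm_nth_blinfun_le: "norm (apply_bcontfun (blinfun_apply B x) m) \<le> norm B * norm x"
  by (rule order_trans[OF norm_bounded norm_blinfun])

text \<open>A uniform limit argument: the error of replacing \<open>B'\<close> by \<open>B j\<close> is uniform along a bounded sequence.\<close>

lemma closed_s_continuous:
  "closed {B :: ('n::finite, 'u::real_normed_vector) linf \<Rightarrow>\<^sub>L ('n, 'u) linf. s_continuous B}"
  unfolding closed_sequential_limits
proof (intro allI impI, elim conjE)
  fix B :: "nat \<Rightarrow> ('n, 'u) linf \<Rightarrow>\<^sub>L ('n, 'u) linf" and B'
  assume B: "\<forall>j. B j \<in> {B. s_continuous B}" and lim: "B \<longlonglongrightarrow> B'"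
  have "s_continuous B'"
  proof (rule s_continuousI)
    fix x :: "nat \<Rightarrow> ('n, 'u) linf" and y m
    assume xy: "strict_conv x y"
    have "bounded (range (\<lambda>n. x n - y))"
      using xy by (auto simp: strict_conv_iff intro: bounded_minus_comp)
    then obtain M where M: "M > 0" "\<And>n. norm (x n - y) \<le> M"
      by (auto simp: bounded_pos)
    have "\<exists>N. \<forall>n\<ge>N. norm (B' (x n) m - B' y m) < e" if e: "e > 0" for e
    proof -
      have "e / (2 * M) > 0" using e M by simp
      then obtain j where j: "norm (B j - B') < e / (2 * M)"
        using LIMSEQ_D[OF lim] by blast
      have "(\<lambda>n. B j (x n) m) \<longlonglongrightarrow> B j y m"
        using B xy by (auto intro: s_continuousD)
      then obtain N where N: "\<And>n. n \<ge> N \<Longrightarrow> norm (B j (x n) m - B j y m) < e / 2"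
        using LIMSEQ_D[of _ _ "e/2"] e by (metis half_gt_zero)
      have "norm (B' (x n) m - B' y m) < e" if "n \<ge> N" for n
      proof -
        have "B' (x n) m - B' y m = (B j (x n) m - B j y m) - (B j - B') (x n - y) m"
          by (simp add: blinfun.diff_left blinfun.diff_right)
        also have "norm \<dots> \<le> norm (B j (x n) m - B j y m) + norm ((B j - B') (x n - y) m)"
          by (rule norm_triangle_ineq4)
        also have "norm ((B j - B') (x n - y) m) \<le> norm (B j - B') * norm (x n - y)"
          by (rule norm_nth_blinfun_le)
        also have "\<dots> \<le> e / (2 * M) * M"
          using j M e by (intro mult_mono) auto
        also have "\<dots> = e / 2" using M by simp
        finally show ?thesis using N[OF that] by simp
      qed
      then show ?thesis by blast
    qed
    then show "(\<lambda>n. B' (x n) m) \<longlonglongrightarrow> B' y m" by (rule LIMSEQ_I)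
  qed
  then show "B' \<in> {B. s_continuous B}" by simp
qed

lemma s_continuous_BDO:
  fixes B :: "('n::finite, 'u::complex_normed_vector) linf \<Rightarrow>\<^sub>L ('n, 'u) linf"
  shows "B \<in> BDO \<Longrightarrow> s_continuous B"
proof -
  have "band_operators \<subseteq> {B :: ('n, 'u) linf \<Rightarrow>\<^sub>L ('n, 'u) linf. s_continuous B}"
    by (auto simp: band_operators_def
        intro!: s_continuous_sum s_continuous_compose s_continuous_opM s_continuous_opV)
  then show "B \<in> BDO \<Longrightarrow> s_continuous B"
    unfolding BDO_def using closure_minimal[OF _ closed_s_continuous] by blast
qed

section \<open>Translates, almost periods and limit operators\<close>

type_synonym ('n, 'u) linop = "('n, 'u) linf \<Rightarrow>\<^sub>L ('n, 'u) linf"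

definition translate :: "int ^ 'n::finite \<Rightarrow> ('n, 'u::real_normed_vector) linop \<Rightarrow> ('n, 'u) linop" where
  "translate k A = opV (- k) o\<^sub>L A o\<^sub>L opV k"

text \<open>The hull of an almost periodic operator, as for almost periodic functions.\<close>

definition translation_hull :: "('n::finite, 'u::real_normed_vector) linop \<Rightarrow> ('n, 'u) linop set" where
  "translation_hull A = closure (range (\<lambda>k. translate k A))"

lemma translate_apply: "translate k A x = opV (- k) (A (opV k x))"
  by (simp add: translate_def)

lemma translate_0 [simp]: "translate 0 A = A"
  by (intro blinfun_eqI) (simp add: translate_apply)

lemma translate_translate: "translate k (translate l A) = translate (k + l) A"
  by (intro blinfun_eqI) (simp add: translate_apply add.commute)

lemma translate_diff: "translate k (A - B) = translate k A - translate k B"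
  by (intro blinfun_eqI) (simp add: translate_apply blinfun.diff_left blinfun.diff_right)

lemma translate_add: "translate k (A + B) = translate k A + translate k B"
  by (intro blinfun_eqI) (simp add: translate_apply blinfun.add_left blinfun.add_right)

lemma translate_id [simp]: "translate k id_blinfun = id_blinfun"
  by (intro blinfun_eqI) (simp add: translate_apply)

lemma translate_compose: "translate k (A o\<^sub>L B) = translate k A o\<^sub>L translate k B"
  by (intro blinfun_eqI) (simp add: translate_apply)

lemma norm_translate [simp]: "norm (translate k A) = norm A"
proof -
  have le: "norm (translate k A) \<le> norm A" for k and A :: "('a::finite, 'b::real_normed_vector) linop"
    by (rule norm_blinfun_bound) (use norm_blinfun[of A] in \<open>auto simp: translate_apply intro: order_trans[OF norm_blinfun]\<close>)
  show ?thesis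
    using le[of k A] le[of "- k" "translate k A"] by (simp add: translate_translate)
qed

lemma opV_scaleC: "opV k (c *\<^sub>C x) = c *\<^sub>C opV k x"
  by (auto simp: opV_nth scaleC_nth intro!: bcontfun_eqI)

lemma opP_CL: "opP k \<in> CL"
  by (auto simp: CL_def opP_nth scaleC_nth intro!: bcontfun_eqI)
    (metis norm_eq_zero norm_scaleC mult_zero_right norm_zero)

lemma translate_CL: "A \<in> CL \<Longrightarrow> translate k A \<in> CL"
  by (simp add: CL_def translate_apply opV_scaleC)

lemma translate_in_translation_hull: "translate k A \<in> translation_hull A"
  unfolding translation_hull_def by (rule closure_subset[THEN subsetD]) simp

lemma self_in_translation_hull: "A \<in> translation_hull A"
  using translate_in_translation_hull[of 0 A] by simp

lemma translation_hull_CL: "A \<in> CL \<Longrightarrow> translation_hull A \<subseteq> CL"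
  unfolding translation_hull_def by (rule closure_minimal[OF _ closed_CL]) (auto intro: translate_CL)

lemma norm_rich_iff: "norm_rich A \<longleftrightarrow> compact (translation_hull A)"
  by (simp add: norm_rich_def translation_hull_def translate_def)

lemma norm_translate_diff:
  "norm (translate k A - translate l A) = norm (translate (k - l) A - A)"
proof -
  have "translate k A - translate l A = translate l (translate (k - l) A - A)"
    by (simp add: translate_diff translate_translate)
  then show ?thesis by simp
qed

text \<open>Arbitrarily long almost periods, common to finitely many directions \<open>k\<close>.  Total boundedness puts
  the translates into finitely many classes of small diameter.  By the pigeonhole principle two multiples
  \<open>s a < s b\<close> of \<open>T + 1\<close> lead to the same classes in all directions simultaneously, and their
  difference is the period.\<close>

lemma almost_periods:
  fixes A :: "('n::finite, 'u::real_normed_vector) linop" and T :: nat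
  assumes rich: "norm_rich A" and D: "finite D" and e: "e > 0"
  obtains L :: int where "int T < L" "\<And>k. k \<in> D \<Longrightarrow> norm (translate (L *s k) A - A) < e"
proof -
  have "compact (translation_hull A)" using rich by (simp add: norm_rich_iff)
  then obtain F where F: "finite F" "translation_hull A \<subseteq> (\<Union>B\<in>F. ball B (e / 2))"
    using seq_compact_imp_totally_bounded[of "translation_hull A"] e
    by (meson compact_imp_seq_compact half_gt_zero)
  have "\<forall>k. \<exists>B \<in> F. dist B (translate k A) < e / 2"
    using F(2) translate_in_translation_hull[of _ A] by (fastforce simp: subset_iff)
  then obtain c where c: "\<And>k. c k \<in> F" "\<And>k. dist (c k) (translate k A) < e / 2"
    by (metis (full_types))
  define s where "s n = int n * (int T + 1)" for n :: nat
  define g where "g n = restrict (\<lambda>k. c (s n *s k)) D" for n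
  have "g ` UNIV \<subseteq> D \<rightarrow>\<^sub>E F" by (auto simp: g_def c)
  then have "finite (range g)"
    by (rule finite_subset) (use D F in \<open>auto intro: finite_PiE\<close>)
  then have "\<not> inj g" using finite_imageD by blast
  then obtain a b where "g a = g b" "a \<noteq> b" by (auto simp: inj_def)
  then obtain a b where ab: "g a = g b" "a < b" by (metis linorder_neqE_nat)
  show thesis
  proof (rule that[of "s b - s a"])
    have "int T < 1 * (int T + 1)" by simp
    also have "\<dots> \<le> int (b - a) * (int T + 1)"
      using ab by (intro mult_right_mono) auto
    also have "\<dots> = s b - s a"
      using ab by (simp add: s_def of_nat_diff algebra_simps)
    finally show "int T < s b - s a" .
    fix k assume k: "k \<in> D"
    have eq: "c (s a *s k) = c (s b *s k)"
      using fun_cong[OF ab(1), of k] k by (simp add: g_def)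
    have "norm (translate ((s b - s a) *s k) A - A) = norm (translate (s b *s k - s a *s k) A - A)"
      by (simp add: vector_sub_rdistrib vec_eq_iff algebra_simps)
    also have "\<dots> = dist (translate (s b *s k) A) (translate (s a *s k) A)"
      by (simp only: norm_translate_diff[symmetric] dist_norm)
    also have "\<dots> \<le> dist (c (s b *s k)) (translate (s b *s k) A) + dist (c (s b *s k)) (translate (s a *s k) A)"
      by (rule dist_triangle3)
    also have "\<dots> < e / 2 + e / 2"
      using c(2)[of "s b *s k"] c(2)[of "s a *s k"] eq by (intro add_strict_mono) auto
    finally show "norm (translate ((s b - s a) *s k) A - A) < e" by simp
  qed
qed

lemma P_conv_if_norm_conv:
  assumes "A \<longlonglongrightarrow> B"
  shows "P_conv A B"
  unfolding P_conv_def
proof (intro ballI conjI)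
  fix K :: "('a, 'b) linop"
  have 0: "(\<lambda>n. A n - B) \<longlonglongrightarrow> 0" using assms by (rule LIM_zero)
  show "(\<lambda>n. norm ((A n - B) o\<^sub>L K)) \<longlonglongrightarrow> 0"
    using bounded_bilinear.tendsto[OF bounded_bilinear_blinfun_compose 0 tendsto_const[of K]]
    by (intro tendsto_norm_zero) simp
  show "(\<lambda>n. norm (K o\<^sub>L (A n - B))) \<longlonglongrightarrow> 0"
    using bounded_bilinear.tendsto[OF bounded_bilinear_blinfun_compose tendsto_const[of K] 0]
    by (intro tendsto_norm_zero) simp
qed

lemma opP_KYP: "(opP k :: ('a::finite, 'b::complex_normed_vector) linop) \<in> KYP"
proof -
  have "(opP k :: ('a, 'b) linop) o\<^sub>L opQ n = 0" "opQ n o\<^sub>L (opP k :: ('a, 'b) linop) = 0" if "n \<ge> k" for n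
    using that by (auto intro!: blinfun_eqI bcontfun_eqI
        simp: opQ_def blinfun.diff_left opP_nth blinfun.diff_right)
  then have "eventually (\<lambda>n. norm ((opP k :: ('a, 'b) linop) o\<^sub>L opQ n) = 0) sequentially"
    "eventually (\<lambda>n. norm (opQ n o\<^sub>L (opP k :: ('a, 'b) linop)) = 0) sequentially"
    by (auto simp: eventually_sequentially intro!: exI[of _ k])
  then show ?thesis
    by (auto simp: KYP_def opP_CL intro: tendsto_eventually)
qed

text \<open>The truncations are test operators, and they separate operators.\<close>

lemma P_conv_unique:
  assumes B: "P_conv A B" and C: "P_conv A C"
  shows "B = C"
proof -
  have "opP m o\<^sub>L (B - C) = 0" for m
  proof -
    have lim: "(\<lambda>n. norm (opP m o\<^sub>L (A n - C)) + norm (opP m o\<^sub>L (A n - B))) \<longlonglongrightarrow> 0 + 0"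
      using B C opP_KYP[of m] by (intro tendsto_add) (auto simp: P_conv_def)
    have "opP m o\<^sub>L (B - C) = (opP m o\<^sub>L (A n - C)) - (opP m o\<^sub>L (A n - B))" for n
      by (intro blinfun_eqI) (simp add: blinfun.diff_left blinfun.diff_right)
    then have "norm (opP m o\<^sub>L (B - C)) \<le> norm (opP m o\<^sub>L (A n - C)) + norm (opP m o\<^sub>L (A n - B))" for n
      by (metis norm_triangle_ineq4)
    then have "norm (opP m o\<^sub>L (B - C)) \<le> 0 + 0"
      by (intro tendsto_lowerbound[OF lim] always_eventually) auto
    then show ?thesis by simp
  qed
  then have "(opP m o\<^sub>L (B - C)) x i = 0" for m x i by simp
  then have "opP (nat (maxnorm i)) (B x - C x) i = 0" for x i
    by (simp add: blinfun.diff_left)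
  then show "B = C"
    by (intro blinfun_eqI bcontfun_eqI) (simp add: opP_nth)
qed

text \<open>Almost periodicity trades \<open>\<P>\<close>-convergence along \<open>\<bar>h(n)\<bar> \<rightarrow> \<infinity>\<close> for norm convergence along arbitrary
  translations.  In particular an almost periodic operator is a limit operator of itself.\<close>

lemma sigma_op_eq_translation_hull:
  fixes A :: "('n::finite, 'u::complex_normed_vector) linop"
  assumes rich: "norm_rich A" and CL: "A \<in> CL"
  shows "sigma_op A = translation_hull A"
proof (intro equalityI subsetI)
  fix B assume "B \<in> sigma_op A"
  then obtain h where h: "P_conv (\<lambda>n. translate (h n) A) B"
    by (auto simp: sigma_op_def translate_def)
  have "seq_compact (translation_hull A)"
    using rich by (simp add: norm_rich_iff compact_imp_seq_compact)
  then obtain C and r :: "nat \<Rightarrow> nat" where C: "C \<in> translation_hull A" "strict_mono r"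
      "((\<lambda>n. translate (h n) A) \<circ> r) \<longlonglongrightarrow> C"
    using translate_in_translation_hull by (metis seq_compactE)
  have "P_conv (\<lambda>n. translate (h (r n)) A) C"
    using P_conv_if_norm_conv[OF C(3)] by (simp add: o_def)
  moreover have "P_conv (\<lambda>n. translate (h (r n)) A) B"
    using h LIMSEQ_subseq_LIMSEQ[OF _ C(2)] by (auto simp: P_conv_def o_def)
  ultimately have "B = C" by (rule P_conv_unique[symmetric])
  with C(1) show "B \<in> translation_hull A" by simp
next
  fix B assume B: "B \<in> translation_hull A"
  have "\<forall>n. \<exists>h. int n \<le> maxnorm h \<and> dist (translate h A) B < inverse (real (Suc n))"
  proof
    fix n
    define e where "e = inverse (real (Suc n)) / 2"
    have e: "e > 0" by (simp add: e_def)
    from B obtain k where k: "dist (translate k A) B < e"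
      unfolding translation_hull_def closure_approachable using e by blast
    obtain L where L: "int (n + nat (maxnorm k)) < L"
      "norm (translate (L *s (\<chi> i. 1)) A - A) < e"
      using almost_periods[OF rich _ e, of "{\<chi> i. 1}" "n + nat (maxnorm k)"] by auto
    \<comment> \<open>shifting by an almost period in the diagonal direction pushes \<open>k\<close> to infinity\<close>
    define h where "h = L *s (\<chi> i. 1) + k"
    have "int n \<le> \<bar>h $ undefined\<bar>"
      using L(1) nth_le_maxnorm[of k undefined] by (simp add: h_def)
    also have "\<dots> \<le> maxnorm h" by (rule nth_le_maxnorm)
    finally have "int n \<le> maxnorm h" .
    moreover have "dist (translate h A) (translate k A) < e"
      using L(2) by (simp add: dist_norm norm_translate_diff h_def)
    then have "dist (translate h A) B < inverse (real (Suc n))"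
      using k dist_triangle[of "translate h A" B "translate k A"] by (simp add: e_def)
    ultimately show "\<exists>h. int n \<le> maxnorm h \<and> dist (translate h A) B < inverse (real (Suc n))"
      by blast
  qed
  from choice[OF this] obtain h where h: "\<And>n. int n \<le> maxnorm (h n)"
      "\<And>n. dist (translate (h n) A) B < inverse (real (Suc n))"
    by blast
  have "(\<lambda>n. translate (h n) A) \<longlonglongrightarrow> B"
    by (rule metric_tendsto_imp_tendsto[OF LIMSEQ_inverse_real_of_nat])
      (use h(2) in \<open>auto intro!: always_eventually less_imp_le simp del: of_nat_Suc\<close>)
  then have "P_conv (\<lambda>n. translate (h n) A) B"
    by (rule P_conv_if_norm_conv)
  moreover have "filterlim (\<lambda>n. maxnorm (h n)) at_top sequentially"
    by (rule filterlim_at_top_mono[OF filterlim_int_sequentially]) (simp add: h)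
  moreover have "B \<in> CL" using B translation_hull_CL[OF CL] by blast
  ultimately show "B \<in> sigma_op A"
    unfolding sigma_op_def translate_def by blast
qed

lemma id_CL: "id_blinfun \<in> CL"
  by (simp add: CL_def)

lemma CL_add: "A \<in> CL \<Longrightarrow> B \<in> CL \<Longrightarrow> A + B \<in> CL"
  by (simp add: CL_def blinfun.add_left scaleC_add_right)

lemma CL_diff: "A \<in> CL \<Longrightarrow> B \<in> CL \<Longrightarrow> A - B \<in> CL"
  by (simp add: CL_def blinfun.diff_left
      linear_diff[OF bounded_linear.linear[OF bounded_linear_scaleC]])

lemma sigma_op_id_plus:
  fixes K :: "('n::finite, 'u::complex_normed_vector) linop"
  shows "sigma_op (id_blinfun + K) = (+) id_blinfun ` sigma_op K"
proof -
  have eq: "P_conv (\<lambda>n. translate (h n) (id_blinfun + K)) B \<longleftrightarrow>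
      P_conv (\<lambda>n. translate (h n) K) (B - id_blinfun)" for h and B :: "('n, 'u) linop"
    by (simp add: P_conv_def translate_add diff_diff_eq2 diff_diff_add algebra_simps)
  have mem: "B \<in> sigma_op (id_blinfun + K) \<longleftrightarrow> B - id_blinfun \<in> sigma_op K" for B :: "('n, 'u) linop"
    using eq[of _ B] CL_add[OF id_CL, of "B - id_blinfun"] CL_diff[OF _ id_CL, of B]
    unfolding sigma_op_def translate_def by auto
  show ?thesis
  proof (intro equalityI subsetI)
    fix B assume "B \<in> sigma_op (id_blinfun + K)"
    then show "B \<in> (+) id_blinfun ` sigma_op K"
      using mem[of B] by (intro image_eqI[of _ _ "B - id_blinfun"]) auto
  next
    fix B assume "B \<in> (+) id_blinfun ` sigma_op K"
    then show "B \<in> sigma_op (id_blinfun + K)" using mem[of B] by auto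
  qed
qed

section \<open>Periodisation\<close>

text \<open>The usual metric on the integers makes the index group a metric space, so that bounded functions on it
  with values in a Banach space form a complete space.\<close>

instantiation int :: metric_space
begin

definition dist_int :: "int \<Rightarrow> int \<Rightarrow> real" where
  "dist_int x y = real_of_int \<bar>x - y\<bar>"

definition uniformity_int :: "(int \<times> int) filter" where
  "uniformity_int = (INF e\<in>{0<..}. principal {(x, y). dist x y < e})"

instance
proof
  show "uniformity = (INF e\<in>{0<..}. principal {(x :: int, y). dist x y < e})"
    by (rule uniformity_int_def)
  fix U :: "int set" and x y z :: int
  show "dist x y = 0 \<longleftrightarrow> x = y" by (simp add: dist_int_def)
  show "dist x y \<le> dist x z + dist y z" by (simp add: dist_int_def)
  have ev: "eventually P (uniformity :: (int \<times> int) filter) \<longleftrightarrow> (\<exists>e>0. \<forall>x y. dist x y < e \<longrightarrow> P (x, y))" for P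
    unfolding uniformity_int_def
    by (subst eventually_INF_base)
      (auto simp: eventually_principal subset_eq intro: bexI[of _ "min _ _"])
  have "\<forall>x y :: int. dist x y < 1 \<longrightarrow> x = y"
    unfolding dist_int_def of_int_less_1_iff by simp
  then have "eventually (\<lambda>(x, y). x = y) (uniformity :: (int \<times> int) filter)"
    unfolding ev by (intro exI[of _ 1]) auto
  then have "\<forall>x\<in>U. \<forall>\<^sub>F (x', y) in uniformity. x' = x \<longrightarrow> y \<in> U"
    by (auto elim!: eventually_mono)
  then show "open U \<longleftrightarrow> (\<forall>x\<in>U. \<forall>\<^sub>F (x', y) in uniformity. x' = x \<longrightarrow> y \<in> U)"
    by (simp add: open_discrete)
qed

end

instance bcontfun :: (metric_space, banach) banach ..

lift_definition reindex ::
  "(int ^ 'n::finite \<Rightarrow> int ^ 'n) \<Rightarrow> ('n, 'u::real_normed_vector) linf \<Rightarrow> ('n, 'u) linf"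
  is "\<lambda>\<phi> x m. x (\<phi> m)"
  unfolding bcontfun_int_vec bounded_iff by fastforce

lift_definition opE :: "(int ^ 'n::finite \<Rightarrow> int ^ 'n) \<Rightarrow> ('n, 'u::real_normed_vector) linop"
  is reindex
proof (rule bounded_linear_intro[where K = 1])
  fix \<phi> r and x y :: "('n, 'u) linf"
  show "reindex \<phi> (x + y) = reindex \<phi> x + reindex \<phi> y"
    by (rule bcontfun_eqI) (simp add: reindex.rep_eq)
  show "reindex \<phi> (r *\<^sub>R x) = r *\<^sub>R reindex \<phi> x"
    by (rule bcontfun_eqI) (simp add: reindex.rep_eq)
  show "norm (reindex \<phi> x) \<le> norm x * 1"
    by (rule norm_bound) (simp add: reindex.rep_eq norm_bounded)
qed

lemma opE_nth: "opE \<phi> x m = x (\<phi> m)"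
  by (simp add: opE.rep_eq reindex.rep_eq)

lemma norm_opE_le: "norm (opE \<phi> x) \<le> norm x"
  by (rule norm_bound) (simp add: opE_nth norm_bounded)

text \<open>This turns the Montel property of \<open>K\<close> into compactness of its periodisations.\<close>

lemma opE_strict_to_norm:
  assumes fin: "finite (range \<phi>)" and x: "strict_conv x y"
  shows "(\<lambda>j. opE \<phi> (x j)) \<longlonglongrightarrow> opE \<phi> y"
proof -
  have le: "norm (opE \<phi> (x j) - opE \<phi> y) \<le> (\<Sum>q\<in>range \<phi>. norm (x j q - y q))" for j
    by (rule norm_bound) (auto simp: opE_nth fin intro!: member_le_sum)
  have "(\<lambda>j. norm (x j q - y q)) \<longlonglongrightarrow> 0" for q
    using x by (auto simp: strict_conv_iff intro!: tendsto_norm_zero LIM_zero)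
  then have "(\<lambda>j. \<Sum>q\<in>range \<phi>. norm (x j q - y q)) \<longlonglongrightarrow> 0"
    by (intro tendsto_null_sum)
  then have "(\<lambda>j. opE \<phi> (x j) - opE \<phi> y) \<longlonglongrightarrow> 0"
    by (rule Lim_null_comparison[rotated]) (use le in auto)
  then show ?thesis by (rule LIM_zero_cancel)
qed

text \<open>The representative of \<open>m\<close> modulo \<open>L\<close> in a box centred at the origin.  Centring makes \<open>wrap L\<close> the
  identity on larger and larger balls as \<open>L\<close> grows.  The sequence \<open>x\<close> is \<open>L\<close>-periodic iff \<open>x \<circ> wrap L = x\<close>,
  and \<open>opE (wrap L)\<close> is the projection onto these sequences.\<close>

definition wrap :: "int \<Rightarrow> int ^ 'n \<Rightarrow> int ^ 'n" where
  "wrap L m = (\<chi> i. (m $ i + L div 2) mod L - L div 2)"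

lemma wrap_wrap [simp]: "wrap L (wrap L m) = wrap L m"
  by (simp add: wrap_def vec_eq_iff)

lemma wrap_period [simp]: "wrap L (m - L *s k) = wrap L m"
proof -
  have "(m $ i - L * k $ i + L div 2) mod L = (m $ i + L div 2) mod L" for i
    using mod_mult_self1[of "m $ i + L div 2" "- k $ i" L] by (simp add: algebra_simps)
  then show ?thesis by (simp add: wrap_def vec_eq_iff)
qed

lemma wrap_eq_self:
  assumes "maxnorm m < L div 2"
  shows "wrap L m = m"
proof -
  have "(m $ i + L div 2) mod L = m $ i + L div 2" for i
    using nth_le_maxnorm[of m i] assms by (intro mod_pos_pos_trivial) auto
  then show ?thesis by (simp add: wrap_def vec_eq_iff)
qed

lemma maxnorm_wrap_le:
  assumes "L > 0"
  shows "maxnorm (wrap L m) \<le> L"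
  unfolding maxnorm_le_iff
proof
  fix i
  have "0 \<le> (m $ i + L div 2) mod L" "(m $ i + L div 2) mod L < L" using assms by auto
  moreover have "0 \<le> L div 2" "L div 2 \<le> L" using assms by auto
  ultimately show "\<bar>wrap L m $ i\<bar> \<le> L" by (simp add: wrap_def abs_le_iff)
qed

lemma finite_range_wrap: "L > 0 \<Longrightarrow> finite (range (wrap L :: int ^ 'n \<Rightarrow> int ^ 'n))"
  by (rule finite_subset[OF _ finite_maxnorm_le[of L]]) (auto simp: maxnorm_wrap_le)

text \<open>A point within distance \<open>L\<close> of the box lies in the box or in one of the boxes adjacent to it, so that
  only finitely many translations, independent of \<open>L\<close> up to scaling, have to be almost periods.\<close>

lemma wrap_nearby:
  fixes m n :: "int ^ 'n"
  assumes "L > 0" "maxnorm m \<le> L" "wrap L n = n"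
  obtains k where "maxnorm k \<le> 1" "m + n = wrap L (m + n) + L *s k"
proof (rule that[of "\<chi> i. ((m + n) $ i + L div 2) div L"])
  let ?k = "\<chi> i. ((m + n) $ i + L div 2) div L"
  show "m + n = wrap L (m + n) + L *s ?k"
    using div_mult_mod_eq[of _ L]
    by (auto simp: wrap_def vec_eq_iff algebra_simps minus_mod_eq_mult_div[symmetric])
  have "\<bar>?k $ i\<bar> \<le> 1" for i
  proof -
    define s where "s = (m + n) $ i + L div 2"
    have "n $ i = (n $ i + L div 2) mod L - L div 2"
      using arg_cong[OF assms(3), of "\<lambda>v. v $ i"] by (simp add: wrap_def)
    moreover have "0 \<le> (n $ i + L div 2) mod L" "(n $ i + L div 2) mod L < L" using assms(1) by auto
    moreover have "- L \<le> m $ i" "m $ i \<le> L" using nth_le_maxnorm[of m i] assms(2) by auto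
    ultimately have s: "- L \<le> s" "s < 2 * L" unfolding s_def by auto
    have "(- L) div L \<le> s div L" using s(1) assms(1) by (intro zdiv_mono1) auto
    moreover have "s div L \<le> (2 * L - 1) div L" using s(2) assms(1) by (intro zdiv_mono1) auto
    moreover have "(2 * L - 1) div L = 1"
      using assms(1) by (intro int_div_pos_eq[of _ _ _ "L - 1"]) auto
    moreover have "(- L) div L = - 1"
      using nonzero_mult_div_cancel_right[of L "- 1"] assms(1) by simp
    moreover have "?k $ i = s div L" by (simp add: s_def)
    ultimately show ?thesis using assms(1) by (simp only: abs_le_iff) simp
  qed
  then show "maxnorm ?k \<le> 1" by (simp add: maxnorm_le_iff)
qed

text \<open>The point \<open>m + n\<close> equals \<open>q + L k\<close> with \<open>q\<close> in the box.  Because \<open>x\<close> is invariant under the shift by \<open>L k\<close>,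
  the value of \<open>K x\<close> at \<open>q + L k\<close> is that of the translate of \<open>K\<close> by \<open>L k\<close>, applied to \<open>x\<close>, at \<open>q\<close>;
  this is near \<open>K x q\<close>, which the periodisation reproduces.\<close>

lemma periodisation_residual:
  fixes K :: "('n::finite, 'u::real_normed_vector) linop" and x :: "('n, 'u) linf"
  assumes L: "L > 0" and per: "\<And>q. x (wrap L q) = x q"
    and near: "\<And>k. maxnorm k \<le> 1 \<Longrightarrow> norm (translate (L *s k) K - K) \<le> e"
    and m: "maxnorm m \<le> L" and n: "wrap L n = n"
  shows "norm (apply_bcontfun (x + K x) (m + n)) \<le> norm (x + opE (wrap L) (K x)) + e * norm x"
proof -
  obtain k where k: "maxnorm k \<le> 1" "m + n = wrap L (m + n) + L *s k"
    using wrap_nearby[OF L m n] by blast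
  define q where "q = wrap L (m + n)"
  have "opV (L *s k) x = x"
    by (rule bcontfun_eqI) (metis opV_nth per wrap_period)
  then have "(translate (L *s k) K - K) x q = K x (m + n) - K x q"
    using k(2) by (simp add: translate_apply blinfun.diff_left opV_nth q_def)
  moreover have "x (m + n) = x q" by (simp add: q_def per)
  ultimately have "apply_bcontfun (x + K x) (m + n) = apply_bcontfun (x + opE (wrap L) (K x)) q + (translate (L *s k) K - K) x q"
    by (simp add: opE_nth q_def)
  also have "norm \<dots> \<le> norm (apply_bcontfun (x + opE (wrap L) (K x)) q) + norm ((translate (L *s k) K - K) x q)"
    by (rule norm_triangle_ineq)
  also have "\<dots> \<le> norm (x + opE (wrap L) (K x)) + norm (translate (L *s k) K - K) * norm x"
    by (intro add_mono norm_bounded norm_nth_blinfun_le)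
  also have "\<dots> \<le> norm (x + opE (wrap L) (K x)) + e * norm x"
    by (intro add_mono mult_right_mono near k) auto
  finally show ?thesis .
qed

section \<open>Operators satisfying the condition of Favard\<close>

lemma s_continuous_translation_hull:
  assumes "s_continuous K" "B \<in> translation_hull K"
  shows "s_continuous B"
proof -
  have "translation_hull K \<subseteq> {B. s_continuous B}"
    unfolding translation_hull_def translate_def
    by (rule closure_minimal[OF _ closed_s_continuous])
      (auto intro: s_continuous_compose s_continuous_opV assms)
  with assms(2) show ?thesis by blast
qed

lemma exists_nth_ge_half:
  fixes x :: "('n::finite, 'u::real_normed_vector) linf"
  assumes "norm x = 1"
  obtains m where "1 / 2 \<le> norm (x m)"
proof -
  have "\<not> (\<forall>m. norm (x m) \<le> 1 / 2)"
    using norm_bound[of x "1 / 2"] assms by auto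
  then show thesis using that by (auto simp: not_le intro: less_imp_le)
qed

text \<open>The last assumption says that all limit operators of \<open>I + K\<close> are injective, as in the classical theorem of
  Favard on almost periodic differential equations.\<close>

locale favard =
  fixes K :: "('n::finite, 'u::banach) linop"
  assumes norm_rich: "norm_rich K"
    and s_continuous: "s_continuous K"
    and Montel: "uniformly_Montel (translation_hull K)"
    and injective: "\<And>B x. B \<in> translation_hull K \<Longrightarrow> x + B x = 0 \<Longrightarrow> x = 0"
begin

text \<open>Translating \<open>k\<^sub>j\<close> to the origin turns \<open>x\<^sub>j\<close> into \<open>z\<^sub>j\<close> and \<open>K\<close> into \<open>T\<^sub>j\<close> with \<open>z\<^sub>j + T\<^sub>j z\<^sub>j \<rightarrow> 0\<close> entrywise.
  Along a subsequence \<open>T\<^sub>j z\<^sub>j \<rightarrow> y\<close> strictly by the Montel property, hence \<open>z\<^sub>j \<rightarrow> - y\<close>, and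
  \<open>T\<^sub>j \<rightarrow> B\<close> in norm by compactness of the hull.  As \<open>B\<close> is strictly continuous, \<open>- y\<close> is in the kernel
  of \<open>I + B\<close>, but its entry at \<open>0\<close> has norm at least \<open>c\<close>.\<close>

lemma no_approximate_kernel:
  assumes bdd: "bounded (range x)"
    and lim: "\<And>m. (\<lambda>j. apply_bcontfun (x j + K (x j)) (m + k j)) \<longlonglongrightarrow> 0"
    and c: "c > 0" "\<And>j. c \<le> norm (x j (k j))"
  shows False
proof -
  define z where "z j = opV (- k j) (x j)" for j
  define T where "T j = translate (k j) K" for j
  have Tz: "T j (z j) m = K (x j) (m + k j)" and z: "z j m = x j (m + k j)" for j m
    by (simp_all add: T_def z_def translate_apply opV_nth)
  have bz: "bounded (range z)"
    using bdd by (simp add: bounded_iff z_def)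
  have T: "T j \<in> translation_hull K" for j
    by (simp add: T_def translate_in_translation_hull)
  obtain r1 :: "nat \<Rightarrow> nat" and y where r1: "strict_mono r1" "strict_conv (\<lambda>n. T (r1 n) (z (r1 n))) y"
    using Montel[unfolded uniformly_Montel_def, rule_format, of T z] bz T by blast
  have "seq_compact (translation_hull K)"
    using norm_rich by (simp add: norm_rich_iff compact_imp_seq_compact)
  then obtain B and r2 :: "nat \<Rightarrow> nat" where B: "B \<in> translation_hull K" and r2: "strict_mono r2"
    and TB: "((\<lambda>n. T (r1 n)) \<circ> r2) \<longlonglongrightarrow> B"
    using T by (metis seq_compactE)
  define s where "s n = r1 (r2 n)" for n
  have s: "strict_mono s"
    using r1(1) r2 by (simp add: s_def strict_mono_def)
  have Ty: "(\<lambda>n. T (s n) (z (s n)) m) \<longlonglongrightarrow> y m" for m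
    using r1(2) LIMSEQ_subseq_LIMSEQ[OF _ r2] by (auto simp: strict_conv_iff s_def o_def)
  have zy: "(\<lambda>n. z (s n) m) \<longlonglongrightarrow> apply_bcontfun (- y) m" for m
    using tendsto_diff[OF LIMSEQ_subseq_LIMSEQ[OF lim[of m] s] Ty[of m]]
    by (simp add: o_def Tz z)
  have "bounded (range (\<lambda>n. z (s n)))"
    by (rule bounded_subset[OF bz]) auto
  then have "strict_conv (\<lambda>n. z (s n)) (- y)"
    using zy by (simp add: strict_conv_iff)
  then have Bz: "(\<lambda>n. B (z (s n)) m) \<longlonglongrightarrow> B (- y) m" for m
    by (rule s_continuousD[OF s_continuous_translation_hull[OF s_continuous B]])
  obtain M where M: "\<And>j. norm (z j) \<le> M"
    using bz by (auto simp: bounded_iff)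
  have "(\<lambda>n. norm (T (s n) - B) * M) \<longlonglongrightarrow> 0"
    using TB by (intro tendsto_mult_left_zero tendsto_norm_zero LIM_zero) (simp add: s_def o_def)
  then have diff: "(\<lambda>n. (T (s n) - B) (z (s n)) m) \<longlonglongrightarrow> 0" for m
    by (rule Lim_null_comparison[rotated])
      (auto intro!: always_eventually order_trans[OF norm_nth_blinfun_le] mult_left_mono M)
  have "(\<lambda>n. T (s n) (z (s n)) m) \<longlonglongrightarrow> B (- y) m" for m
    using tendsto_add[OF diff[of m] Bz[of m]] by (simp add: blinfun.diff_left)
  then have "y m = B (- y) m" for m
    by (rule LIMSEQ_unique[OF Ty])
  then have "- y + B (- y) = 0"
    by (intro bcontfun_eqI) simp
  with B have "- y = 0" by (rule injective)
  then have "(\<lambda>n. norm (z (s n) 0)) \<longlonglongrightarrow> 0"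
    using tendsto_norm[OF zy[of 0]] by simp
  then have "c \<le> 0"
    by (rule tendsto_lowerbound) (auto simp: z c)
  with c(1) show False by simp
qed

lemma lower_bound: "\<exists>c>0. \<forall>x. c * norm x \<le> norm (x + K x)"
proof (rule ccontr)
  assume *: "\<nexists>c. c > 0 \<and> (\<forall>x. c * norm x \<le> norm (x + K x))"
  have "\<exists>x m. norm x = 1 \<and> norm (x + K x) \<le> inverse (real (Suc j)) \<and> 1 / 2 \<le> norm (apply_bcontfun x m)" for j
  proof -
    have "inverse (real (Suc j)) > 0" by simp
    with * have "\<not> (\<forall>x. inverse (real (Suc j)) * norm x \<le> norm (x + K x))" by blast
    then obtain v where "\<not> inverse (real (Suc j)) * norm v \<le> norm ((id_blinfun + K) v)"
      by (auto simp: blinfun.add_left)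
    then obtain x where "norm x = 1" "norm ((id_blinfun + K) x) \<le> inverse (real (Suc j))"
      using unit_vector_below[of UNIV] by (metis UNIV_I)
    then have "norm x = 1" "norm (x + K x) \<le> inverse (real (Suc j))"
      by (simp_all add: blinfun.add_left)
    then show ?thesis using exists_nth_ge_half[of x] by metis
  qed
  then have "\<forall>j. \<exists>p. norm (fst p) = 1 \<and> norm (fst p + K (fst p)) \<le> inverse (real (Suc j))
      \<and> 1 / 2 \<le> norm (apply_bcontfun (fst p) (snd p))"
    by (metis fst_conv snd_conv)
  from choice[OF this] obtain p where p: "\<And>j. norm (fst (p j)) = 1"
      "\<And>j. norm (fst (p j) + K (fst (p j))) \<le> inverse (real (Suc j))"
      "\<And>j. 1 / 2 \<le> norm (apply_bcontfun (fst (p j)) (snd (p j)))"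
    by blast
  show False
  proof (rule no_approximate_kernel[of "\<lambda>j. fst (p j)" "\<lambda>j. snd (p j)" "1 / 2"])
    show "bounded (range (\<lambda>j. fst (p j)))" by (rule boundedI[where B = 1]) (auto simp: p)
    fix m
    have "norm (apply_bcontfun (fst (p j) + K (fst (p j))) (m + snd (p j))) \<le> inverse (real (Suc j))" for j
      by (rule order_trans[OF norm_bounded p(2)])
    then show "(\<lambda>j. apply_bcontfun (fst (p j) + K (fst (p j))) (m + snd (p j))) \<longlonglongrightarrow> 0"
      by (intro Lim_null_comparison[OF _ LIMSEQ_inverse_real_of_nat] always_eventually) blast
  qed (use p(3) in auto)
qed

text \<open>If the bound failed along \<open>j \<rightarrow> \<infinity>\<close>, there would be periodic unit vectors \<open>x\<^sub>i\<close>, large at points \<open>n\<^sub>i\<close>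
  which periodicity allows to be taken in the box, for which the residual estimate makes \<open>x\<^sub>i + K x\<^sub>i\<close>
  small on balls around \<open>n\<^sub>i\<close> whose radius tends to infinity.\<close>

lemma periodic_lower_bound:
  assumes L: "\<And>j. int j < L j"
    and near: "\<And>j k. maxnorm k \<le> 1 \<Longrightarrow> norm (translate (L j *s k) K - K) \<le> inverse (real (Suc j))"
  shows "\<exists>c>0. \<exists>J. \<forall>j\<ge>J. \<forall>x. (\<forall>m. apply_bcontfun x (wrap (L j) m) = apply_bcontfun x m) \<longrightarrow>
    c * norm x \<le> norm (x + opE (wrap (L j)) (K x))"
proof (rule ccontr)
  assume *: "\<not> ?thesis"
  have Lpos: "L j > 0" for j using L[of j] by linarith
  define good where "good i j x n \<longleftrightarrow> i \<le> j \<and> norm x = 1 \<and>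
      (\<forall>m. apply_bcontfun x (wrap (L j) m) = apply_bcontfun x m) \<and>
      norm (x + opE (wrap (L j)) (K x)) \<le> inverse (real (Suc i)) \<and>
      wrap (L j) n = n \<and> 1 / 2 \<le> norm (apply_bcontfun x n)" for i j x n
  have "\<forall>i. \<exists>j x n. good i j x n"
  proof
    fix i
    let ?c = "inverse (real (Suc i))"
    have "?c > 0" by simp
    with * obtain j where j: "i \<le> j"
      "\<not> (\<forall>x. (\<forall>m. apply_bcontfun x (wrap (L j) m) = apply_bcontfun x m) \<longrightarrow> ?c * norm x \<le> norm (x + opE (wrap (L j)) (K x)))"
      by blast
    define S where "S = {x :: ('n, 'u) linf. \<forall>m. x (wrap (L j) m) = x m}"
    define T where "T = id_blinfun + (opE (wrap (L j)) o\<^sub>L K)"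
    have T: "T x = x + opE (wrap (L j)) (K x)" for x
      by (simp add: T_def blinfun.add_left)
    obtain v where v: "v \<in> S" "\<not> ?c * norm v \<le> norm (T v)"
      using j(2) by (auto simp: S_def T simp del: of_nat_Suc)
    have "t *\<^sub>R x \<in> S" if "x \<in> S" for t x using that by (simp add: S_def)
    from unit_vector_below[OF this v]
    obtain x where x: "x \<in> S" "norm x = 1" "norm (x + opE (wrap (L j)) (K x)) \<le> ?c"
      unfolding T by blast
    obtain m where "1 / 2 \<le> norm (x m)" using exists_nth_ge_half[OF x(2)] .
    then have "good i j x (wrap (L j) m)"
      using x j(1) by (simp add: good_def S_def del: of_nat_Suc)
    then show "\<exists>j x n. good i j x n" by blast
  qed
  then obtain a x n where *: "\<And>i. good i (a i) (x i) (n i)"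
    by metis
  have good: "i \<le> a i" "norm (x i) = 1" "\<And>m. x i (wrap (L (a i)) m) = x i m"
      "norm (x i + opE (wrap (L (a i))) (K (x i))) \<le> inverse (real (Suc i))"
      "wrap (L (a i)) (n i) = n i" "1 / 2 \<le> norm (x i (n i))" for i
    using *[of i] by (simp_all add: good_def del: of_nat_Suc)
  show False
  proof (rule no_approximate_kernel[of x n "1 / 2"])
    show "bounded (range x)" by (rule boundedI[where B = 1]) (auto simp: good)
    fix m
    have "norm (apply_bcontfun (x i + K (x i)) (m + n i)) \<le> inverse (real (Suc i)) + inverse (real (Suc i))"
      if i: "i \<ge> nat (maxnorm m)" for i
    proof -
      have "maxnorm m \<le> L (a i)" using i good(1)[of i] L[of "a i"] by linarith
      then have "norm (apply_bcontfun (x i + K (x i)) (m + n i)) \<le>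
          norm (x i + opE (wrap (L (a i))) (K (x i))) + inverse (real (Suc (a i))) * norm (x i)"
        by (intro periodisation_residual Lpos good near)
      also have "\<dots> \<le> inverse (real (Suc i)) + inverse (real (Suc i))"
        using good(1)[of i] by (intro add_mono good(4)) (simp add: good(2) le_imp_inverse_le)
      finally show ?thesis .
    qed
    then have "eventually (\<lambda>i. norm (apply_bcontfun (x i + K (x i)) (m + n i)) \<le>
        inverse (real (Suc i)) + inverse (real (Suc i))) sequentially"
      unfolding eventually_sequentially by blast
    moreover have "(\<lambda>i. inverse (real (Suc i)) + inverse (real (Suc i))) \<longlonglongrightarrow> 0"
      using tendsto_add[OF LIMSEQ_inverse_real_of_nat LIMSEQ_inverse_real_of_nat] by simp
    ultimately show "(\<lambda>i. apply_bcontfun (x i + K (x i)) (m + n i)) \<longlonglongrightarrow> 0"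
      by (rule Lim_null_comparison)
  qed (use good(6) in auto)
qed

lemma image_has_strict_limit:
  assumes "bounded (range x)"
  shows "\<exists>(r :: nat \<Rightarrow> nat) y. strict_mono r \<and> strict_conv (\<lambda>n. K (x (r n))) y"
proof -
  have "range (\<lambda>_::nat. K) \<subseteq> translation_hull K" by (simp add: self_in_translation_hull)
  then show ?thesis using Montel assms unfolding uniformly_Montel_def by blast
qed

text \<open>A periodised equation is solved for each large almost period \<open>L\<close>, and a strict limit of the solutions
  as \<open>L \<rightarrow> \<infinity>\<close> solves the equation itself.\<close>

lemma surjective: "\<exists>x. x + K x = y"
proof -
  have "\<forall>j. \<exists>L. int j < L \<and> (\<forall>k. maxnorm k \<le> 1 \<longrightarrow> norm (translate (L *s k) K - K) \<le> inverse (real (Suc j)))"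
  proof
    fix j
    show "\<exists>L. int j < L \<and> (\<forall>k. maxnorm k \<le> 1 \<longrightarrow> norm (translate (L *s k) K - K) \<le> inverse (real (Suc j)))"
      using almost_periods[OF norm_rich finite_maxnorm_le[of 1], of "inverse (real (Suc j))" j]
      by (metis (mono_tags, lifting) inverse_positive_iff_positive less_imp_le mem_Collect_eq of_nat_0_less_iff zero_less_Suc)
  qed
  from choice[OF this] obtain L where L: "\<And>j. int j < L j"
    and near: "\<And>j k. maxnorm k \<le> 1 \<Longrightarrow> norm (translate (L j *s k) K - K) \<le> inverse (real (Suc j))"
    by blast
  have Lpos: "L j > 0" for j using L[of j] by linarith
  define E :: "nat \<Rightarrow> ('n, 'u) linop" where "E j = opE (wrap (L j))" for j
  have E_nth: "E j w m = apply_bcontfun w (wrap (L j) m)" for j w m by (simp add: E_def opE_nth)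
  obtain c J where c: "c > 0"
    and lower: "\<And>j x. j \<ge> J \<Longrightarrow> (\<And>m. apply_bcontfun x (wrap (L j) m) = apply_bcontfun x m) \<Longrightarrow> c * norm x \<le> norm (x + E j (K x))"
    using periodic_lower_bound[OF L near] unfolding E_def by blast
  have solve: "\<exists>x. x + E j (K x) = E j y" if j: "j \<ge> J" for j
  proof -
    have "\<exists>x. x + (E j o\<^sub>L K) x = E j y"
    proof (rule surj_of_inj_compact_perturbation[of "E j o\<^sub>L K" "E j y"])
      fix x :: "nat \<Rightarrow> ('n, 'u) linf" assume "bounded (range x)"
      then obtain r :: "nat \<Rightarrow> nat" and w where r: "strict_mono r" "strict_conv (\<lambda>n. K (x (r n))) w"
        using image_has_strict_limit by blast
      have "(\<lambda>n. (E j o\<^sub>L K) (x (r n))) \<longlonglongrightarrow> E j w"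
        using opE_strict_to_norm[OF finite_range_wrap[OF Lpos] r(2)] by (simp add: E_def)
      with r(1) show "\<exists>r :: nat \<Rightarrow> nat. strict_mono r \<and> convergent (\<lambda>n. (E j o\<^sub>L K) (x (r n)))"
        by (auto simp: convergent_def)
    next
      fix x assume x0: "x + (E j o\<^sub>L K) x = 0"
      then have "x = - E j (K x)" by (simp add: eq_neg_iff_add_eq_0)
      then have "x q = - K x (wrap (L j) q)" for q
        by (metis E_nth uminus_bcontfun.rep_eq)
      \<comment> \<open>a kernel element is periodic, so the lower bound for periodic sequences applies to it\<close>
      then have "x (wrap (L j) q) = x q" for q by simp
      from lower[OF j this] x0 c show "x = 0" by (simp add: mult_le_0_iff)
    qed
    then show ?thesis by simp
  qed
  have "\<forall>j. \<exists>x. x + E (j + J) (K x) = E (j + J) y" using solve by simp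
  from choice[OF this] obtain x where x: "\<And>j. x j + E (j + J) (K (x j)) = E (j + J) y" by blast
  have x_nth: "x j m = y (wrap (L (j + J)) m) - K (x j) (wrap (L (j + J)) m)" for j m
    using arg_cong[OF x[of j], of "\<lambda>w. w m"] by (simp add: E_nth eq_diff_eq)
  have bx: "norm (x j) \<le> norm y / c" for j
  proof -
    have "c * norm (x j) \<le> norm (x j + E (j + J) (K (x j)))"
      by (rule lower) (simp_all add: x_nth)
    also have "\<dots> \<le> norm y" unfolding x unfolding E_def by (rule norm_opE_le)
    finally show ?thesis using c by (simp add: field_simps)
  qed
  then have "bounded (range x)" by (auto simp: bounded_iff)
  then obtain r :: "nat \<Rightarrow> nat" and w where r: "strict_mono r" and w: "strict_conv (\<lambda>n. K (x (r n))) w"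
    using image_has_strict_limit by blast
  have lim: "(\<lambda>n. x (r n) m) \<longlonglongrightarrow> apply_bcontfun (y - w) m" for m
  proof -
    have "x (r n) m = y m - K (x (r n)) m" if "n \<ge> nat (2 * maxnorm m + 2)" for n
    proof -
      have "2 * maxnorm m + 2 \<le> L (r n + J)"
        using L[of "r n + J"] seq_suble[OF r, of n] that by linarith
      then have "maxnorm m < L (r n + J) div 2" by linarith
      then show ?thesis by (simp add: x_nth wrap_eq_self)
    qed
    then have "eventually (\<lambda>n. y m - K (x (r n)) m = x (r n) m) sequentially"
      unfolding eventually_sequentially by metis
    moreover have "(\<lambda>n. y m - K (x (r n)) m) \<longlonglongrightarrow> apply_bcontfun (y - w) m"
      using w by (auto simp: strict_conv_iff intro!: tendsto_diff)
    ultimately show ?thesis by (rule Lim_transform_eventually[rotated])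
  qed
  have "bounded (range (\<lambda>n. x (r n)))" using bx by (auto simp: bounded_iff)
  with lim have "strict_conv (\<lambda>n. x (r n)) (y - w)" by (simp add: strict_conv_iff)
  then have "(\<lambda>n. K (x (r n)) m) \<longlonglongrightarrow> K (y - w) m" for m
    by (rule s_continuousD[OF s_continuous])
  moreover have "(\<lambda>n. K (x (r n)) m) \<longlonglongrightarrow> w m" for m
    using w by (simp add: strict_conv_iff)
  ultimately have "K (y - w) = w"
    by (intro bcontfun_eqI) (metis LIMSEQ_unique)
  then have "(y - w) + K (y - w) = y" by simp
  then show ?thesis by blast
qed

end

section \<open>The equivalences\<close>

lemma is_inverse_translate:
  assumes "is_inverse A D"
  shows "is_inverse (translate k A) (translate k D)"
  using assms by (simp add: is_inverse_def translate_CL translate_compose[symmetric])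

theorem theorem6p38:
  fixes A K :: "('n::finite, 'u::complex_banach) linf \<Rightarrow>\<^sub>L ('n, 'u) linf"
  assumes "A = id_blinfun + K"
    and "K \<in> BDO"
    and "norm_rich K"
    and "uniformly_Montel (sigma_op K)"
  shows "((\<exists>B. is_inverse A B) \<longleftrightarrow> bounded_below A) \<and>
    (bounded_below A \<longleftrightarrow> (\<forall>B \<in> sigma_op A. inj (blinfun_apply B))) \<and>
    ((\<forall>B \<in> sigma_op A. inj (blinfun_apply B)) \<longleftrightarrow>
      (\<exists>C::real. \<forall>B \<in> sigma_op A. \<exists>D. is_inverse B D \<and> norm D \<le> C))"
    (is "(?i \<longleftrightarrow> ?ii) \<and> (?ii \<longleftrightarrow> ?iii) \<and> (?iii \<longleftrightarrow> ?iv)")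
proof -
  have K_CL: "K \<in> CL" using assms(2) BDO_subset_CL by blast
  have sigma_K: "sigma_op K = translation_hull K"
    by (rule sigma_op_eq_translation_hull[OF assms(3) K_CL])
  have sigma_A: "sigma_op A = (+) id_blinfun ` translation_hull K"
    by (simp add: assms(1) sigma_op_id_plus sigma_K)
  have A_CL: "A \<in> CL" by (simp add: assms(1) CL_add id_CL K_CL)
  have A: "A x = x + K x" for x by (simp add: assms(1) blinfun.add_left)
  have approx: "\<exists>k. (\<lambda>n. translate (k n) A) \<longlonglongrightarrow> B" if "B \<in> sigma_op A" for B
  proof -
    from that obtain B' where B': "B = id_blinfun + B'" "B' \<in> closure (range (\<lambda>k. translate k K))"
      by (auto simp: sigma_A translation_hull_def)
    then obtain f where f: "\<forall>n. f n \<in> range (\<lambda>k. translate k K)" "f \<longlonglongrightarrow> B'"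
      unfolding closure_sequential by blast
    then have "\<forall>n. \<exists>k. f n = translate k K" by blast
    from choice[OF this] obtain k where "f = (\<lambda>n. translate (k n) K)" by auto
    then have "(\<lambda>n. translate (k n) A) \<longlonglongrightarrow> B"
      using f(2) by (simp add: assms(1) translate_add B' tendsto_intros)
    then show ?thesis by blast
  qed
  have "?i" if iii: ?iii
  proof -
    interpret favard K
    proof
      show "norm_rich K" by fact
      show "s_continuous K" using assms(2) by (rule s_continuous_BDO)
      show "uniformly_Montel (translation_hull K)" using assms(4) by (simp add: sigma_K)
      fix B x assume "B \<in> translation_hull K" and 0: "x + B x = 0"
      then have "inj (blinfun_apply (id_blinfun + B))" using iii by (auto simp: sigma_A)
      moreover have "(id_blinfun + B) x = (id_blinfun + B) 0" using 0 by (simp add: blinfun.add_left)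
      ultimately show "x = 0" by (rule injD)
    qed
    show ?i
      using lower_bound surjective is_inverse_of_lower_bound[OF A_CL] by (simp add: A) blast
  qed
  moreover have "?ii" if i: ?i
  proof -
    from i obtain D where D: "is_inverse A D" by blast
    have "norm x \<le> (norm D + 1) * norm (A x)" for x
    proof -
      have "x = D (A x)"
        using D unfolding is_inverse_def by (metis blinfun_apply_blinfun_compose blinfun_apply_id_blinfun id_apply)
      then have "norm x \<le> norm D * norm (A x)" by (metis norm_blinfun)
      then show ?thesis by (simp add: distrib_right add_increasing2)
    qed
    then have "1 / (norm D + 1) * norm x \<le> norm (A x)" for x
      by (simp add: field_simps add_pos_nonneg add_nonneg_pos pos_divide_le_eq)
    moreover have "1 / (norm D + 1) > 0" by (simp add: add_nonneg_pos)
    ultimately show ?ii unfolding bounded_below_iff by blast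
  qed
  moreover have "?iii" if ii: ?ii
  proof
    fix B assume "B \<in> sigma_op A"
    then obtain k where k: "(\<lambda>n. translate (k n) A) \<longlonglongrightarrow> B" using approx by blast
    from ii obtain c where c: "c > 0" "\<And>x. c * norm x \<le> norm (A x)"
      unfolding bounded_below_iff by blast
    have lower: "c * norm x \<le> norm (B x)" for x
    proof (rule tendsto_lowerbound)
      show "(\<lambda>n. norm (translate (k n) A x)) \<longlonglongrightarrow> norm (B x)"
        by (intro tendsto_norm blinfun.tendsto[OF k] tendsto_const)
      show "\<forall>\<^sub>F n in sequentially. c * norm x \<le> norm (translate (k n) A x)"
        using c(2)[of "opV _ x"] by (intro always_eventually) (simp add: translate_apply)
    qed simp
    have "x = y" if "B x = B y" for x y
      using lower[of "x - y"] c(1) that by (simp add: blinfun.diff_right mult_le_0_iff)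
    then show "inj (blinfun_apply B)" by (rule injI)
  qed
  moreover have "?iv" if i: ?i
  proof -
    from i obtain D where D: "is_inverse A D" by blast
    have "\<exists>D'. is_inverse B D' \<and> norm D' \<le> norm D" if "B \<in> sigma_op A" for B
      using approx[OF that] is_inverse_limit[OF _ is_inverse_translate[OF D]] by fastforce
    then show ?iv by blast
  qed
  moreover have "?iii" if iv: ?iv
  proof
    fix B assume "B \<in> sigma_op A"
    with iv obtain D where "is_inverse B D" by blast
    then have "D (B x) = x" for x
      unfolding is_inverse_def by (metis blinfun_apply_blinfun_compose blinfun_apply_id_blinfun id_apply)
    then show "inj (blinfun_apply B)" by (metis injI)
  qed
  ultimately show ?thesis by blast
qed

end
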